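(* Let $G$ be a torus-free protorus and $L$ a sublattice of $\mathrm{L}(G)$ satisfying $\bigcap L=0$. Then the group $\widehat{\Delta}_L$, topologized by taking $L$ to be an open neighborhood basis at $0$, is a periodic $\widehat{\mathbb{Z}}$-module with $\widehat{\mathbb{Z}}g=\overline{\mathbb{Z}g}$ for each $g\in\widehat{\Delta}_L$, and $\widehat{\Delta}_L\times\mathfrak{L}(G)$ is locally compact with closed subgroup $\Gamma_L$. The identity map from $\widehat{\Delta}_L$ with this topology to $\widehat{\Delta}_L$ with the subspace topology (from $G$) is continuous.
   Context: All groups are abelian, topological groups are Hausdorff, compact groups are finite-dimensional. A protorus is a compact connected abelian group; a torus is a group topologically isomorphic to $(\mathbb{R}/\mathbb{Z})^k$, $k$ a positive integer; torus-free means containing no subgroup topologically isomorphic to a torus. $\mathfrak{L}(G)$ is the real topological vector space of continuous homomorphisms $\mathbb{R}\to G$ (topology of compact convergence), $\exp_G(r)=r(1)$ (injective for torus-free $G$). $\mathrm{L}(G)$ is the set of profinite subgroups $\Delta\subset G$ with $G/\Delta$ a torus; it is a lattice with join $+$ and meet $\cap$. $\mathbb{Z}_\Delta=\Delta\cap\exp_G\mathfrak{L}(G)$. For a sublattice $L\subseteq\mathrm{L}(G)$ with $\bigcap L=0$: $\widehat{\Delta}_L=\sum_{\Delta\in L}\Delta$, $V_L=\sum_{\Delta\in L}\mathbb{Z}_\Delta=\bigcup_{\Delta\in L}\mathbb{Z}_\Delta$, $\Gamma_L=\{(\alpha,-\exp_G^{-1}\alpha):\alpha\in V_L\}$. $\widehat{\mathbb{Z}}$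 is the ring of profinite integers. A locally compact abelian group $K$ is periodic if it is totally disconnected and $\overline{\mathbb{Z}g}$ is compact for each $g\in K$. *)

theory Defs
  imports "HOL-Analysis.Analysis" "HOL-Algebra.Algebra"
begin

text \<open>Abelian groups are written multiplicatively, following HOL-Algebra, and topological groups are
  pairs of a group record and an abstract topology on its carrier. In particular the join
  \<open>\<Delta> + \<Delta>'\<close> of subgroups is \<open>set_mult\<close> and the sum of a family of subgroups is the
  subgroup generated by its union.\<close>

locale topological_comm_group = comm_group G for G (structure) +
  fixes T :: "'a topology"
  assumes topspace_eq: "topspace T = carrier G"
    and continuous_mult: "continuous_map (prod_topology T T) T (\<lambda>(x, y). x \<otimes> y)"
    and continuous_inv: "continuous_map T T (\<lambda>x. inv x)"
    and Hausdorff: "Hausdorff_space T"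

definition topgroup_isomorphic ::
  "('a, 'm) monoid_scheme \<Rightarrow> 'a topology \<Rightarrow> ('b, 'n) monoid_scheme \<Rightarrow> 'b topology \<Rightarrow> bool" where
  "topgroup_isomorphic G T H S \<longleftrightarrow> (\<exists>f. f \<in> iso G H \<and> homeomorphic_map T S f)"

definition quotient_topology :: "'a topology \<Rightarrow> ('a \<Rightarrow> 'b) \<Rightarrow> 'b topology" where
  "quotient_topology T f =
     topology (\<lambda>U. U \<subseteq> f ` topspace T \<and> openin T {x \<in> topspace T. f x \<in> U})"

lemma openin_quotient_topology:
  "openin (quotient_topology T f) U \<longleftrightarrow>
     U \<subseteq> f ` topspace T \<and> openin T {x \<in> topspace T. f x \<in> U}"
proof -
  have "istopology (\<lambda>U. U \<subseteq> f ` topspace T \<and> openin T {x \<in> topspace T. f x \<in> U})"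
    (is "istopology ?P")
    unfolding istopology_def
  proof (intro conjI allI impI)
    fix U V assume UV: "?P U" "?P V"
    then show "U \<inter> V \<subseteq> f ` topspace T" by blast
    have "{x \<in> topspace T. f x \<in> U \<inter> V} =
        {x \<in> topspace T. f x \<in> U} \<inter> {x \<in> topspace T. f x \<in> V}" by blast
    with UV show "openin T {x \<in> topspace T. f x \<in> U \<inter> V}"
      by (simp add: openin_Int)
  next
    fix \<U> assume *: "\<forall>U\<in>\<U>. ?P U"
    then show "\<Union>\<U> \<subseteq> f ` topspace T" by blast
    have "{x \<in> topspace T. f x \<in> \<Union>\<U>} = (\<Union>U\<in>\<U>. {x \<in> topspace T. f x \<in> U})" by blast
    moreover have "openin T (\<Union>U\<in>\<U>. {x \<in> topspace T. f x \<in> U})"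
      using * by blast
    ultimately show "openin T {x \<in> topspace T. f x \<in> \<Union>\<U>}" by simp
  qed
  then show ?thesis
    by (simp add: quotient_topology_def topology_inverse')
qed

lemma topspace_quotient_topology: "topspace (quotient_topology T f) = f ` topspace T"
proof
  show "topspace (quotient_topology T f) \<subseteq> f ` topspace T"
    by (metis openin_quotient_topology openin_topspace)
  have "openin (quotient_topology T f) (f ` topspace T)"
    by (simp add: openin_quotient_topology cong: conj_cong)
  then show "f ` topspace T \<subseteq> topspace (quotient_topology T f)"
    by (rule openin_subset)
qed

lemma quotient_map_quotient_topology: "quotient_map T (quotient_topology T f) f"
  by (simp add: quotient_map_def topspace_quotient_topology openin_quotient_topology)

definition coset_topology :: "('a, 'm) monoid_scheme \<Rightarrow> 'a topology \<Rightarrow> 'a set \<Rightarrow> 'a set topology" where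
  "coset_topology G T H = quotient_topology T (\<lambda>x. H #>\<^bsub>G\<^esub> x)"

definition real_group :: "real monoid" where
  "real_group = \<lparr>carrier = UNIV, monoid.mult = (+), monoid.one = 0\<rparr>"

definition torus_group :: "nat \<Rightarrow> (nat \<Rightarrow> real set) monoid" where
  "torus_group k = product_group {..<k} (\<lambda>_. real_group Mod \<int>)"

definition torus_topology :: "nat \<Rightarrow> (nat \<Rightarrow> real set) topology" where
  "torus_topology k = product_topology (\<lambda>_. coset_topology real_group euclideanreal \<int>) {..<k}"

definition is_torus :: "('a, 'm) monoid_scheme \<Rightarrow> 'a topology \<Rightarrow> bool" where
  "is_torus G T \<longleftrightarrow> (\<exists>k\<ge>1. topgroup_isomorphic G T (torus_group k) (torus_topology k))"

definition torus_free :: "('a, 'm) monoid_scheme \<Rightarrow> 'a topology \<Rightarrow> bool" where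
  "torus_free G T \<longleftrightarrow>
     \<not> (\<exists>H. subgroup H G \<and> is_torus (G\<lparr>carrier := H\<rparr>) (subtopology T H))"

definition lie_group :: "('a, 'm) monoid_scheme \<Rightarrow> 'a topology \<Rightarrow> (real \<Rightarrow> 'a) monoid" where
  "lie_group G T =
     \<lparr>carrier = {f \<in> hom real_group G. continuous_map euclideanreal T f},
      monoid.mult = (\<lambda>f g t. f t \<otimes>\<^bsub>G\<^esub> g t),
      monoid.one = (\<lambda>t. \<one>\<^bsub>G\<^esub>)\<rparr>"

definition lie_scale :: "real \<Rightarrow> (real \<Rightarrow> 'a) \<Rightarrow> real \<Rightarrow> 'a" where
  "lie_scale c f = (\<lambda>t. f (c * t))"

text \<open>The topology of compact convergence: a neighbourhood base at \<open>f\<close> is given by the sets of those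
  \<open>g\<close> with \<open>g t - f t \<in> U\<close> for all \<open>t \<in> C\<close>, where \<open>C\<close> is compact and \<open>U\<close> is an
  open neighbourhood of the identity.\<close>

definition lie_topology :: "('a, 'm) monoid_scheme \<Rightarrow> 'a topology \<Rightarrow> (real \<Rightarrow> 'a) topology" where
  "lie_topology G T = topology (\<lambda>W. W \<subseteq> carrier (lie_group G T) \<and>
     (\<forall>f\<in>W. \<exists>C U. compact C \<and> openin T U \<and> \<one>\<^bsub>G\<^esub> \<in> U \<and>
        {g \<in> carrier (lie_group G T). \<forall>t\<in>C. g t \<otimes>\<^bsub>G\<^esub> inv\<^bsub>G\<^esub> f t \<in> U} \<subseteq> W))"

lemma openin_lie_topology:
  "openin (lie_topology G T) W \<longleftrightarrow> W \<subseteq> carrier (lie_group G T) \<and>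
     (\<forall>f\<in>W. \<exists>C U. compact C \<and> openin T U \<and> \<one>\<^bsub>G\<^esub> \<in> U \<and>
        {g \<in> carrier (lie_group G T). \<forall>t\<in>C. g t \<otimes>\<^bsub>G\<^esub> inv\<^bsub>G\<^esub> f t \<in> U} \<subseteq> W)"
proof -
  let ?N = "\<lambda>f C U. {g \<in> carrier (lie_group G T). \<forall>t\<in>C. g t \<otimes>\<^bsub>G\<^esub> inv\<^bsub>G\<^esub> f t \<in> U}"
  let ?P = "\<lambda>W. W \<subseteq> carrier (lie_group G T) \<and>
     (\<forall>f\<in>W. \<exists>C U. compact C \<and> openin T U \<and> \<one>\<^bsub>G\<^esub> \<in> U \<and> ?N f C U \<subseteq> W)"
  have "istopology ?P"
    unfolding istopology_def
  proof (intro conjI allI impI)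
    fix V W assume V: "?P V" and W: "?P W"
    then show "V \<inter> W \<subseteq> carrier (lie_group G T)" by blast
    show "\<forall>f\<in>V \<inter> W. \<exists>C U. compact C \<and> openin T U \<and> \<one>\<^bsub>G\<^esub> \<in> U \<and> ?N f C U \<subseteq> V \<inter> W"
    proof
      fix f assume f: "f \<in> V \<inter> W"
      obtain C1 U1 where 1: "compact C1" "openin T U1" "\<one>\<^bsub>G\<^esub> \<in> U1" "?N f C1 U1 \<subseteq> V"
        using bspec[OF conjunct2[OF V] IntD1[OF f]] by (elim exE conjE)
      obtain C2 U2 where 2: "compact C2" "openin T U2" "\<one>\<^bsub>G\<^esub> \<in> U2" "?N f C2 U2 \<subseteq> W"
        using bspec[OF conjunct2[OF W] IntD2[OF f]] by (elim exE conjE)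
      have "?N f (C1 \<union> C2) (U1 \<inter> U2) \<subseteq> V \<inter> W" using 1(4) 2(4) by blast
      then show "\<exists>C U. compact C \<and> openin T U \<and> \<one>\<^bsub>G\<^esub> \<in> U \<and> ?N f C U \<subseteq> V \<inter> W"
        using 1(1-3) 2(1-3)
        by (intro exI[of _ "C1 \<union> C2"] exI[of _ "U1 \<inter> U2"] conjI compact_Un openin_Int IntI)
    qed
  next
    fix \<W> assume *: "\<forall>W\<in>\<W>. ?P W"
    show "\<Union>\<W> \<subseteq> carrier (lie_group G T)"
      by (rule Union_least) (rule conjunct1[OF bspec[OF *]])
    show "\<forall>f\<in>\<Union>\<W>. \<exists>C U. compact C \<and> openin T U \<and> \<one>\<^bsub>G\<^esub> \<in> U \<and> ?N f C U \<subseteq> \<Union>\<W>"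
    proof
      fix f assume "f \<in> \<Union>\<W>"
      then obtain W where W: "W \<in> \<W>" "f \<in> W" by blast
      obtain C U where "compact C" "openin T U" "\<one>\<^bsub>G\<^esub> \<in> U" "?N f C U \<subseteq> W"
        using bspec[OF conjunct2[OF bspec[OF * W(1)]] W(2)] by (elim exE conjE)
      moreover from this(4) have "?N f C U \<subseteq> \<Union>\<W>"
        by (rule order_trans) (rule Union_upper[OF W(1)])
      ultimately show "\<exists>C U. compact C \<and> openin T U \<and> \<one>\<^bsub>G\<^esub> \<in> U \<and> ?N f C U \<subseteq> \<Union>\<W>"
        by (intro exI conjI)
    qed
  qed
  then show ?thesis
    by (simp add: lie_topology_def topology_inverse')
qed

definition lie_exp :: "(real \<Rightarrow> 'a) \<Rightarrow> 'a" where
  "lie_exp r = r 1"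

text \<open>The dimension of a compact abelian group \<open>G\<close> is the dimension of the real vector space of
  continuous homomorphisms from the reals to \<open>G\<close>.\<close>

definition finite_dimensional :: "('a, 'm) monoid_scheme \<Rightarrow> 'a topology \<Rightarrow> bool" where
  "finite_dimensional G T \<longleftrightarrow>
     (\<exists>B. finite B \<and> B \<subseteq> carrier (lie_group G T) \<and>
       (\<forall>f\<in>carrier (lie_group G T). \<exists>c.
          f = finprod (lie_group G T) (\<lambda>b. lie_scale (c b) b) B))"

definition protorus :: "('a, 'm) monoid_scheme \<Rightarrow> 'a topology \<Rightarrow> bool" where
  "protorus G T \<longleftrightarrow> topological_comm_group G T \<and> compact_space T \<and> connected_space T \<and>
     finite_dimensional G T"

definition totally_disconnected_space :: "'a topology \<Rightarrow> bool" where
  "totally_disconnected_space T \<longleftrightarrow> (\<forall>S. connectedin T S \<longrightarrow> (\<exists>x. S \<subseteq> {x}))"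

definition profinite_subgroup :: "('a, 'm) monoid_scheme \<Rightarrow> 'a topology \<Rightarrow> 'a set \<Rightarrow> bool" where
  "profinite_subgroup G T \<Delta> \<longleftrightarrow> subgroup \<Delta> G \<and>
     compact_space (subtopology T \<Delta>) \<and> totally_disconnected_space (subtopology T \<Delta>)"

definition profinite_lattice :: "('a, 'm) monoid_scheme \<Rightarrow> 'a topology \<Rightarrow> 'a set set" where
  "profinite_lattice G T =
     {\<Delta>. profinite_subgroup G T \<Delta> \<and> is_torus (G Mod \<Delta>) (coset_topology G T \<Delta>)}"

definition profinite_sublattice ::
  "('a, 'm) monoid_scheme \<Rightarrow> 'a topology \<Rightarrow> 'a set set \<Rightarrow> bool" where
  "profinite_sublattice G T L \<longleftrightarrow> L \<noteq> {} \<and> L \<subseteq> profinite_lattice G T \<and>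
     (\<forall>\<Delta>\<in>L. \<forall>\<Delta>'\<in>L. \<Delta> <#>\<^bsub>G\<^esub> \<Delta>' \<in> L \<and> \<Delta> \<inter> \<Delta>' \<in> L)"

definition Delta_hat :: "('a, 'm) monoid_scheme \<Rightarrow> 'a set set \<Rightarrow> ('a, 'm) monoid_scheme" where
  "Delta_hat G L = G\<lparr>carrier := generate G (\<Union>L)\<rparr>"

text \<open>The topology on \<open>Delta_hat G L\<close> with open neighbourhood basis \<open>L\<close> at the identity; that
  it is a topology needs \<open>L\<close> to be closed under intersections.\<close>

definition Delta_hat_topology :: "('a, 'm) monoid_scheme \<Rightarrow> 'a set set \<Rightarrow> 'a topology" where
  "Delta_hat_topology G L =
     topology (\<lambda>U. U \<subseteq> carrier (Delta_hat G L) \<and> (\<forall>x\<in>U. \<exists>\<Delta>\<in>L. x <#\<^bsub>G\<^esub> \<Delta> \<subseteq> U))"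

lemma openin_Delta_hat_topology:
  assumes "\<And>\<Delta> \<Delta>'. \<Delta> \<in> L \<Longrightarrow> \<Delta>' \<in> L \<Longrightarrow> \<Delta> \<inter> \<Delta>' \<in> L"
  shows "openin (Delta_hat_topology G L) U \<longleftrightarrow>
    U \<subseteq> carrier (Delta_hat G L) \<and> (\<forall>x\<in>U. \<exists>\<Delta>\<in>L. x <#\<^bsub>G\<^esub> \<Delta> \<subseteq> U)"
proof -
  let ?P = "\<lambda>U. U \<subseteq> carrier (Delta_hat G L) \<and> (\<forall>x\<in>U. \<exists>\<Delta>\<in>L. x <#\<^bsub>G\<^esub> \<Delta> \<subseteq> U)"
  have "istopology ?P"
    unfolding istopology_def
  proof (intro conjI allI impI)
    fix U V assume U: "?P U" and V: "?P V"
    then show "U \<inter> V \<subseteq> carrier (Delta_hat G L)" by blast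
    show "\<forall>x\<in>U \<inter> V. \<exists>\<Delta>\<in>L. x <#\<^bsub>G\<^esub> \<Delta> \<subseteq> U \<inter> V"
    proof
      fix x assume "x \<in> U \<inter> V"
      then obtain \<Delta>1 \<Delta>2 where "\<Delta>1 \<in> L" "x <#\<^bsub>G\<^esub> \<Delta>1 \<subseteq> U" "\<Delta>2 \<in> L" "x <#\<^bsub>G\<^esub> \<Delta>2 \<subseteq> V"
        using U V by blast
      then show "\<exists>\<Delta>\<in>L. x <#\<^bsub>G\<^esub> \<Delta> \<subseteq> U \<inter> V"
        using assms by (intro bexI[of _ "\<Delta>1 \<inter> \<Delta>2"]) (auto simp: l_coset_def)
    qed
  next
    fix \<U> assume "\<forall>U\<in>\<U>. ?P U"
    then show "\<Union>\<U> \<subseteq> carrier (Delta_hat G L)" "\<forall>x\<in>\<Union>\<U>. \<exists>\<Delta>\<in>L. x <#\<^bsub>G\<^esub> \<Delta> \<subseteq> \<Union>\<U>"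
      by (blast, meson Union_iff Union_upper order_trans)
  qed
  then show ?thesis
    by (simp add: Delta_hat_topology_def topology_inverse')
qed

lemma Delta_hat_topology_neighbourhood_basis:
  assumes "group G" and "profinite_sublattice G T L"
  shows "topspace (Delta_hat_topology G L) = carrier (Delta_hat G L)"
    and "\<And>\<Delta>. \<Delta> \<in> L \<Longrightarrow> openin (Delta_hat_topology G L) \<Delta> \<and> \<one>\<^bsub>G\<^esub> \<in> \<Delta>"
    and "\<And>U. openin (Delta_hat_topology G L) U \<Longrightarrow> \<one>\<^bsub>G\<^esub> \<in> U \<Longrightarrow> \<exists>\<Delta>\<in>L. \<Delta> \<subseteq> U"
proof -
  interpret group G by fact
  have L: "L \<noteq> {}" "\<And>\<Delta> \<Delta>'. \<Delta> \<in> L \<Longrightarrow> \<Delta>' \<in> L \<Longrightarrow> \<Delta> \<inter> \<Delta>' \<in> L"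
    and sub: "\<And>\<Delta>. \<Delta> \<in> L \<Longrightarrow> subgroup \<Delta> G"
    using assms(2)
    by (auto simp: profinite_sublattice_def profinite_lattice_def profinite_subgroup_def)
  have op: "openin (Delta_hat_topology G L) U \<longleftrightarrow>
      U \<subseteq> carrier (Delta_hat G L) \<and> (\<forall>x\<in>U. \<exists>\<Delta>\<in>L. x <#\<^bsub>G\<^esub> \<Delta> \<subseteq> U)" for U
    by (rule openin_Delta_hat_topology) (rule L(2))
  have gen: "\<Delta> \<subseteq> carrier (Delta_hat G L)" if "\<Delta> \<in> L" for \<Delta>
    using that by (auto simp: Delta_hat_def intro: generate.incl)
  have coset: "x <#\<^bsub>G\<^esub> \<Delta> \<subseteq> carrier (Delta_hat G L)"
    if "\<Delta> \<in> L" "x \<in> carrier (Delta_hat G L)" for x \<Delta>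
    using that gen[OF that(1)] by (auto simp: Delta_hat_def l_coset_def intro: generate.eng)
  have "openin (Delta_hat_topology G L) (carrier (Delta_hat G L))"
  proof (subst op, intro conjI ballI)
    fix x assume "x \<in> carrier (Delta_hat G L)"
    moreover obtain \<Delta> where "\<Delta> \<in> L" using L(1) by blast
    ultimately show "\<exists>\<Delta>\<in>L. x <#\<^bsub>G\<^esub> \<Delta> \<subseteq> carrier (Delta_hat G L)"
      using coset by (intro bexI[of _ \<Delta>])
  qed simp_all
  moreover have "topspace (Delta_hat_topology G L) \<subseteq> carrier (Delta_hat G L)"
    using openin_topspace[of "Delta_hat_topology G L"] by (subst (asm) op) simp
  ultimately show "topspace (Delta_hat_topology G L) = carrier (Delta_hat G L)"
    by (simp add: openin_subset subset_antisym)
  show "openin (Delta_hat_topology G L) \<Delta> \<and> \<one>\<^bsub>G\<^esub> \<in> \<Delta>" if "\<Delta> \<in> L" for \<Delta>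
  proof
    have "x <#\<^bsub>G\<^esub> \<Delta> \<subseteq> \<Delta>" if "x \<in> \<Delta>" for x
      using that subgroup.m_closed[OF sub[OF \<open>\<Delta> \<in> L\<close>]] by (auto simp: l_coset_def)
    then show "openin (Delta_hat_topology G L) \<Delta>"
      using that by (subst op) (intro conjI ballI gen bexI[of _ \<Delta>])
    show "\<one>\<^bsub>G\<^esub> \<in> \<Delta>"
      by (rule subgroup.one_closed[OF sub[OF that]])
  qed
  show "\<exists>\<Delta>\<in>L. \<Delta> \<subseteq> U" if U: "openin (Delta_hat_topology G L) U" "\<one>\<^bsub>G\<^esub> \<in> U" for U
  proof -
    have "\<forall>x\<in>U. \<exists>\<Delta>\<in>L. x <#\<^bsub>G\<^esub> \<Delta> \<subseteq> U"
      using U(1) by (subst (asm) op) simp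
    then obtain \<Delta> where \<Delta>: "\<Delta> \<in> L" "\<one>\<^bsub>G\<^esub> <#\<^bsub>G\<^esub> \<Delta> \<subseteq> U" using U(2) by metis
    moreover have "\<one>\<^bsub>G\<^esub> <#\<^bsub>G\<^esub> \<Delta> = \<Delta>"
      by (rule lcos_mult_one[OF subgroup.subset[OF sub[OF \<Delta>(1)]]])
    ultimately show ?thesis by auto
  qed
qed

definition Z_Delta :: "('a, 'm) monoid_scheme \<Rightarrow> 'a topology \<Rightarrow> 'a set \<Rightarrow> 'a set" where
  "Z_Delta G T \<Delta> = \<Delta> \<inter> lie_exp ` carrier (lie_group G T)"

definition V_sum :: "('a, 'm) monoid_scheme \<Rightarrow> 'a topology \<Rightarrow> 'a set set \<Rightarrow> 'a set" where
  "V_sum G T L = generate G (\<Union>\<Delta>\<in>L. Z_Delta G T \<Delta>)"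

definition Gamma_subgroup :: "('a, 'm) monoid_scheme \<Rightarrow> 'a topology \<Rightarrow> 'a set set \<Rightarrow> ('a \<times> (real \<Rightarrow> 'a)) set" where
  "Gamma_subgroup G T L =
     (\<lambda>\<alpha>. (\<alpha>, inv\<^bsub>lie_group G T\<^esub> (inv_into (carrier (lie_group G T)) lie_exp \<alpha>))) ` V_sum G T L"

definition locally_compact_group :: "('a, 'm) monoid_scheme \<Rightarrow> 'a topology \<Rightarrow> bool" where
  "locally_compact_group K S \<longleftrightarrow> topological_comm_group K S \<and> locally_compact_space S"

definition periodic_group :: "('a, 'm) monoid_scheme \<Rightarrow> 'a topology \<Rightarrow> bool" where
  "periodic_group K S \<longleftrightarrow> locally_compact_group K S \<and> totally_disconnected_space S \<and>
     (\<forall>g\<in>carrier K. compactin S (S closure_of generate K {g}))"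

text \<open>The profinite integers as the inverse limit of the rings \<open>\<int>/n\<int>\<close> for \<open>n \<ge> 1\<close>, a residue class
  being represented by its element in \<open>{0..<n}\<close>.\<close>

definition Zhat :: "(nat \<Rightarrow> int) ring" where
  "Zhat =
     \<lparr>carrier = {x \<in> (\<Pi>\<^sub>E n\<in>{1..}. {0..<int n}). \<forall>m\<ge>1. \<forall>n\<ge>1. m dvd n \<longrightarrow> x n mod int m = x m},
      monoid.mult = (\<lambda>x y. \<lambda>n\<in>{1..}. (x n * y n) mod int n),
      monoid.one = (\<lambda>n\<in>{1..}. 1 mod int n),
      ring.zero = (\<lambda>n\<in>{1..}. 0),
      ring.add = (\<lambda>x y. \<lambda>n\<in>{1..}. (x n + y n) mod int n)\<rparr>"

definition Zhat_topology :: "(nat \<Rightarrow> int) topology" where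
  "Zhat_topology =
     subtopology (product_topology (\<lambda>n. discrete_topology {0..<int n}) {1..}) (carrier Zhat)"

text \<open>The group operation of \<open>K\<close> becomes the addition of the module. The fields \<open>mult\<close> and \<open>one\<close>
  play no role in the library's notion of a module.\<close>

definition module_of :: "('a, 'm) monoid_scheme \<Rightarrow> ('r \<Rightarrow> 'a \<Rightarrow> 'a) \<Rightarrow> ('r, 'a) module" where
  "module_of K s =
     \<lparr>carrier = carrier K, monoid.mult = monoid.mult K, monoid.one = monoid.one K,
      ring.zero = monoid.one K, ring.add = monoid.mult K, module.smult = s\<rparr>"

text \<open>Modules over the profinite integers have a jointly continuous scalar multiplication. Since the
  integers are dense in \<open>Zhat\<close>, a Hausdorff group has at most one such module structure.\<close>

definition topological_Zhat_module ::
  "('a, 'm) monoid_scheme \<Rightarrow> 'a topology \<Rightarrow> ((nat \<Rightarrow> int) \<Rightarrow> 'a \<Rightarrow> 'a) \<Rightarrow> bool" where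
  "topological_Zhat_module K S s \<longleftrightarrow> Module.module Zhat (module_of K s) \<and>
     continuous_map (prod_topology Zhat_topology S) S (\<lambda>(z, g). s z g)"

end

theory Submission
  imports Defs
begin

text \<open>
  Write \<open>D\<close> for the group generated by the members of \<open>L\<close>, with the topology in which they form a
  neighbourhood basis at the identity, and \<open>\<LL>\<close> for the group of one-parameter subgroups of \<open>G\<close>.

  The driving fact is that two members \<open>\<Delta>\<close>, \<open>\<Delta>'\<close> of \<open>L\<close> are commensurable. Being profinite, \<open>\<Delta>\<close> has
  arbitrarily small open subgroups; being a torus, \<open>G/\<Delta>'\<close> has a neighbourhood of the identity that
  contains no nontrivial subgroup. So some open subgroup of \<open>\<Delta>\<close> dies in \<open>G/\<Delta>'\<close>, which says that
  \<open>\<Delta> \<inter> \<Delta>'\<close> is open in \<open>\<Delta>\<close> (\<open>profinite_lattice_commensurable\<close>). Hence every \<open>\<Delta>\<close> in \<open>L\<close> stays compact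
  in the finer topology of \<open>D\<close>, where it is also open (\<open>compactin_TD\<close>), and \<open>D\<close> is locally compact.
  Since \<open>L\<close> is closed under finite intersections and has trivial intersection, compactness puts
  members of \<open>L\<close> inside every neighbourhood of the identity of \<open>G\<close>, so the identity map from \<open>D\<close> to
  \<open>G\<close> is continuous. The members of \<open>L\<close> are clopen in \<open>D\<close> and intersect trivially, so \<open>D\<close> is totally
  disconnected; each of its elements lies in a compact subgroup from \<open>L\<close>, so \<open>D\<close> is periodic.

  By commensurability every \<open>g\<close> in \<open>D\<close> has a positive power in every \<open>\<Delta>\<close>. For a profinite integer
  \<open>z\<close> the coset of \<open>g ^ z n\<close> modulo \<open>\<Delta>\<close> is therefore the same for all \<open>n\<close> with \<open>g ^ n \<in> \<Delta>\<close>, and \<open>z\<close>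
  acts on \<open>g\<close> by choosing the unique element that lies in all these cosets: one exists by
  compactness, and only one because \<open>L\<close> has trivial intersection. The module laws and the joint
  continuity are calculations with congruences modulo the members of \<open>L\<close>. The orbit of \<open>g\<close> is a compact
  set containing the powers of \<open>g\<close> as a dense subset, so it is the closure of the cyclic group.

  The group \<open>\<LL>\<close> is a finite-dimensional Hausdorff topological vector space, and the classical
  argument that such a space is locally compact applies (\<open>locally_compact_lie\<close>): on a cube of
  coefficients, forming linear combinations of a minimal spanning set is continuous, the boundary of
  the cube has a compact image that misses the origin, and a balanced neighbourhood of the origin
  disjoint from that image lies inside the image of the cube.

  Finally, if a nontrivial one-parameter subgroup takes the identity as its value at time \<open>1\<close>, then its
  kernel is infinite cyclic and its image is a one-dimensional torus. So torus-freeness makes the exponential map injective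
  (\<open>inj_on_lie_exp\<close>), and \<open>\<Gamma>\<close> becomes the kernel of the homomorphism \<open>(\<alpha>, f) \<mapsto> \<alpha> \<cdot> f 1\<close> from
  \<open>D \<times> \<LL>\<close> to \<open>G\<close> (\<open>Gamma_subgroup_eq\<close>). This homomorphism is continuous because the identity from \<open>D\<close>
  to \<open>G\<close> is, and \<open>G\<close> is Hausdorff; so the kernel is closed.
\<close>

section \<open>Groups topologised by a neighbourhood basis at the identity\<close>

lemma (in group) in_l_coset_iff:
  assumes "x \<in> carrier G" "N \<subseteq> carrier G"
  shows "y \<in> x <# N \<longleftrightarrow> y \<in> carrier G \<and> inv x \<otimes> y \<in> N"
proof
  assume "y \<in> x <# N"
  then obtain n where "n \<in> N" "y = x \<otimes> n" by (auto simp: l_coset_def)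
  with assms show "y \<in> carrier G \<and> inv x \<otimes> y \<in> N"
    by (metis inv_solve_left m_closed subsetD)
next
  assume "y \<in> carrier G \<and> inv x \<otimes> y \<in> N"
  moreover from this have "y = x \<otimes> (inv x \<otimes> y)"
    using assms by (metis inv_closed inv_solve_left m_closed)
  ultimately show "y \<in> x <# N" unfolding l_coset_def by blast
qed

text \<open>The topologies on the group generated by a lattice of profinite subgroups and on the group of
  one-parameter subgroups are both given by the translates of a family of sets around the identity.
  The axioms below make the group operations continuous.\<close>

locale basis_at_identity = comm_group G for G (structure) +
  fixes T :: "'a topology" and \<N> :: "'a set set"
  assumes openin_iff: "openin T U \<longleftrightarrow> U \<subseteq> carrier G \<and> (\<forall>x\<in>U. \<exists>N\<in>\<N>. x <# N \<subseteq> U)"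
    and basis_nonempty: "\<N> \<noteq> {}"
    and basis_subset: "N \<in> \<N> \<Longrightarrow> N \<subseteq> carrier G"
    and one_in_basis: "N \<in> \<N> \<Longrightarrow> \<one> \<in> N"
    and basis_mult: "N \<in> \<N> \<Longrightarrow> \<exists>M\<in>\<N>. M <#> M \<subseteq> N"
    and basis_inv: "N \<in> \<N> \<Longrightarrow> \<exists>M\<in>\<N>. \<forall>x\<in>M. inv x \<in> N"
begin

lemma topspace_eq_carrier: "topspace T = carrier G"
proof
  show "topspace T \<subseteq> carrier G" using openin_iff by blast
  obtain N where "N \<in> \<N>" using basis_nonempty by blast
  then have "openin T (carrier G)"
    using basis_subset by (subst openin_iff) (auto simp: l_coset_def)
  then show "carrier G \<subseteq> topspace T" by (rule openin_subset)
qed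

lemma open_nhd_within_coset:
  assumes x: "x \<in> carrier G" and N: "N \<in> \<N>"
  obtains V where "openin T V" "x \<in> V" "V \<subseteq> x <# N"
proof
  \<comment> \<open>the interior of the coset; it is open because the basis sets can be halved\<close>
  let ?V = "{y \<in> carrier G. \<exists>M\<in>\<N>. y <# M \<subseteq> x <# N}"
  note cos = in_l_coset_iff[OF _ basis_subset]
  show "x \<in> ?V" using x N by blast
  show "?V \<subseteq> x <# N"
    using one_in_basis cos by fastforce
  show "openin T ?V"
    unfolding openin_iff
  proof (intro conjI ballI)
    fix y assume "y \<in> ?V"
    then obtain M where y: "y \<in> carrier G" and M: "M \<in> \<N>" "y <# M \<subseteq> x <# N" by blast
    obtain M' where M': "M' \<in> \<N>" "M' <#> M' \<subseteq> M" using basis_mult[OF M(1)] by blast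
    have "z \<in> ?V" if "z \<in> y <# M'" for z
    proof -
      from that obtain m where m: "m \<in> M'" "z = y \<otimes> m" by (auto simp: l_coset_def)
      have mc: "m \<in> carrier G" using m M' basis_subset by blast
      have "z <# M' \<subseteq> y <# M"
      proof
        fix w assume "w \<in> z <# M'"
        then obtain m' where m': "m' \<in> M'" "w = z \<otimes> m'" by (auto simp: l_coset_def)
        have "m' \<in> carrier G" using m' M' basis_subset by blast
        then have "w = y \<otimes> (m \<otimes> m')" using m m' y mc by (simp add: m_assoc)
        moreover have "m \<otimes> m' \<in> M" using M' m m' by (auto simp: set_mult_def)
        ultimately show "w \<in> y <# M" by (auto simp: l_coset_def)
      qed
      then show ?thesis using M M' m y mc by blast
    qed
    then show "\<exists>M\<in>\<N>. y <# M \<subseteq> ?V" using M' by blast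
  qed blast
qed

lemma continuous_map_if_close:
  assumes "f \<in> topspace Y \<rightarrow> carrier G"
    and close: "\<And>x N. x \<in> topspace Y \<Longrightarrow> N \<in> \<N> \<Longrightarrow>
      \<exists>U. openin Y U \<and> x \<in> U \<and> (\<forall>y\<in>U. f y \<in> f x <# N)"
  shows "continuous_map Y T f"
  unfolding continuous_map
proof (intro conjI allI impI)
  show "f ` topspace Y \<subseteq> topspace T" using assms topspace_eq_carrier by auto
  fix V assume V: "openin T V"
  show "openin Y {x \<in> topspace Y. f x \<in> V}"
  proof (subst openin_subopen, intro ballI)
    fix x assume "x \<in> {x \<in> topspace Y. f x \<in> V}"
    then have x: "x \<in> topspace Y" "f x \<in> V" by auto
    then obtain N where N: "N \<in> \<N>" "f x <# N \<subseteq> V" using V openin_iff by blast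
    obtain U where "openin Y U" "x \<in> U" "\<forall>y\<in>U. f y \<in> f x <# N" using close[OF x(1) N(1)] by blast
    then show "\<exists>U. openin Y U \<and> x \<in> U \<and> U \<subseteq> {x \<in> topspace Y. f x \<in> V}"
      using N openin_subset by blast
  qed
qed

lemma continuous_mult_basis: "continuous_map (prod_topology T T) T (\<lambda>(x, y). x \<otimes> y)"
proof (rule continuous_map_if_close)
  show "(\<lambda>(x, y). x \<otimes> y) \<in> topspace (prod_topology T T) \<rightarrow> carrier G"
    by (auto simp: topspace_eq_carrier)
  fix p N assume "p \<in> topspace (prod_topology T T)" and N: "N \<in> \<N>"
  then obtain x y where p: "p = (x, y)" "x \<in> carrier G" "y \<in> carrier G"
    by (auto simp: topspace_eq_carrier)
  obtain M where M: "M \<in> \<N>" "M <#> M \<subseteq> N" using basis_mult[OF N] by blast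
  obtain A where A: "openin T A" "x \<in> A" "A \<subseteq> x <# M" using open_nhd_within_coset p M by metis
  obtain B where B: "openin T B" "y \<in> B" "B \<subseteq> y <# M" using open_nhd_within_coset p M by metis
  have "a \<otimes> b \<in> x \<otimes> y <# N" if "a \<in> A" "b \<in> B" for a b
  proof -
    obtain m n where mn: "m \<in> M" "n \<in> M" "a = x \<otimes> m" "b = y \<otimes> n"
      using \<open>a \<in> A\<close> \<open>b \<in> B\<close> A(3) B(3) unfolding l_coset_def by blast
    then have c: "m \<in> carrier G" "n \<in> carrier G" using M basis_subset by blast+
    have "a \<otimes> b = (x \<otimes> y) \<otimes> (m \<otimes> n)" using mn c p by (simp add: m_ac)
    moreover have "m \<otimes> n \<in> N" using mn M by (auto simp: set_mult_def)
    ultimately show ?thesis by (auto simp: l_coset_def)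
  qed
  then show "\<exists>U. openin (prod_topology T T) U \<and> p \<in> U \<and>
      (\<forall>q\<in>U. (case q of (x, y) \<Rightarrow> x \<otimes> y) \<in> (case p of (x, y) \<Rightarrow> x \<otimes> y) <# N)"
    using A B p by (intro exI[of _ "A \<times> B"]) (auto simp: openin_prod_Times_iff)
qed

lemma continuous_inv_basis: "continuous_map T T (\<lambda>x. inv x)"
proof (rule continuous_map_if_close)
  show "(\<lambda>x. inv x) \<in> topspace T \<rightarrow> carrier G" by (auto simp: topspace_eq_carrier)
  fix x N assume "x \<in> topspace T" and N: "N \<in> \<N>"
  then have x: "x \<in> carrier G" by (simp add: topspace_eq_carrier)
  obtain M where M: "M \<in> \<N>" "\<forall>m\<in>M. inv m \<in> N" using basis_inv[OF N] by blast
  obtain A where A: "openin T A" "x \<in> A" "A \<subseteq> x <# M" using open_nhd_within_coset x M by metis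
  have "inv a \<in> inv x <# N" if "a \<in> A" for a
  proof -
    obtain m where m: "m \<in> M" "a = x \<otimes> m" using \<open>a \<in> A\<close> A(3) unfolding l_coset_def by blast
    then have "m \<in> carrier G" using M basis_subset by blast
    then show ?thesis using m M x by (auto simp: l_coset_def inv_mult)
  qed
  with A show "\<exists>U. openin T U \<and> x \<in> U \<and> (\<forall>y\<in>U. inv y \<in> inv x <# N)" by blast
qed

lemma Hausdorff_basis:
  assumes "\<Inter>\<N> = {\<one>}"
  shows "Hausdorff_space T"
  unfolding Hausdorff_space_def
proof (intro allI impI, elim conjE)
  fix x y assume "x \<in> topspace T" "y \<in> topspace T" and ne: "x \<noteq> y"
  then have xy: "x \<in> carrier G" "y \<in> carrier G" by (auto simp: topspace_eq_carrier)
  have "inv x \<otimes> y \<noteq> \<one>" using ne xy by (metis inv_solve_left inv_closed one_closed r_one)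
  then obtain N where N: "N \<in> \<N>" "inv x \<otimes> y \<notin> N" using assms by blast
  obtain M where M: "M \<in> \<N>" "M <#> M \<subseteq> N" using basis_mult[OF N(1)] by blast
  obtain M' where M': "M' \<in> \<N>" "\<forall>m\<in>M'. inv m \<in> M" using basis_inv[OF M(1)] by blast
  obtain A where A: "openin T A" "x \<in> A" "A \<subseteq> x <# M" using open_nhd_within_coset xy M by metis
  obtain B where B: "openin T B" "y \<in> B" "B \<subseteq> y <# M'" using open_nhd_within_coset xy M' by metis
  have "z \<notin> B" if "z \<in> A" for z
  proof
    assume "z \<in> B"
    then obtain m n where mn: "m \<in> M" "n \<in> M'" "z = x \<otimes> m" "z = y \<otimes> n"
      using \<open>z \<in> A\<close> \<open>z \<in> B\<close> A(3) B(3) unfolding l_coset_def by blast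
    then have c: "m \<in> carrier G" "n \<in> carrier G" using M M' basis_subset by blast+
    have "y = x \<otimes> m \<otimes> inv n" using mn c xy by (metis inv_solve_right m_closed)
    then have "inv x \<otimes> y = m \<otimes> inv n" using c xy by (metis inv_closed inv_solve_left m_assoc m_closed)
    moreover have "m \<otimes> inv n \<in> N" using M M' mn by (auto simp: set_mult_def)
    ultimately show False using N by simp
  qed
  with A B show "\<exists>U V. openin T U \<and> openin T V \<and> x \<in> U \<and> y \<in> V \<and> disjnt U V"
    by (auto simp: disjnt_iff)
qed

lemma topological_comm_group_basis:
  assumes "\<Inter>\<N> = {\<one>}"
  shows "topological_comm_group G T"
  using topspace_eq_carrier continuous_mult_basis continuous_inv_basis Hausdorff_basis[OF assms]
  by unfold_locales

end

section \<open>Topological groups\<close>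

context topological_comm_group
begin

text \<open>Continuity of multiplication at the identity, in the form in which it replaces the halving of an
  \<open>\<epsilon>\<close>.\<close>

lemma open_square_within:
  assumes U: "openin T U" "\<one> \<in> U"
  obtains V where "openin T V" "\<one> \<in> V" "V <#> V \<subseteq> U"
proof -
  let ?S = "{p \<in> topspace (prod_topology T T). (\<lambda>(x, y). x \<otimes> y) p \<in> U}"
  have "openin (prod_topology T T) ?S"
    using openin_continuous_map_preimage[OF continuous_mult U(1)] .
  moreover have "(\<one>, \<one>) \<in> ?S"
    using U by (auto simp: topspace_eq)
  ultimately obtain A B where AB: "openin T A" "openin T B" "\<one> \<in> A" "\<one> \<in> B"
      "A \<times> B \<subseteq> ?S"
    unfolding openin_prod_topology_alt[of T T ?S] by meson
  show thesis
  proof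
    show "openin T (A \<inter> B)" "\<one> \<in> A \<inter> B" using AB by auto
    show "A \<inter> B <#> A \<inter> B \<subseteq> U" using AB(5) by (auto simp: set_mult_def)
  qed
qed

lemma continuous_map_translation:
  assumes "x \<in> carrier G"
  shows "continuous_map T T (\<lambda>y. x \<otimes> y)"
proof -
  have "continuous_map T (prod_topology T T) (\<lambda>y. (x, y))"
    using assms by (auto simp: continuous_map_pairwise o_def topspace_eq)
  from continuous_map_compose[OF this continuous_mult] show ?thesis by (simp add: o_def)
qed

lemma continuous_map_mult:
  assumes "continuous_map Y T f" "continuous_map Y T g"
  shows "continuous_map Y T (\<lambda>x. f x \<otimes> g x)"
proof -
  have "continuous_map Y (prod_topology T T) (\<lambda>x. (f x, g x))"
    using assms by (auto simp: continuous_map_pairwise o_def)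
  from continuous_map_compose[OF this continuous_mult] show ?thesis by (simp add: o_def)
qed

lemma subgroup_topological_comm_group:
  assumes "subgroup H G"
  shows "topological_comm_group (G\<lparr>carrier := H\<rparr>) (subtopology T H)"
proof -
  have sub: "H \<subseteq> carrier G" using assms by (rule subgroup.subset)
  interpret H: comm_group "G\<lparr>carrier := H\<rparr>"
    using sub by (intro group.group_comm_groupI subgroup_imp_group[OF assms]) (auto intro!: m_comm)
  show ?thesis
  proof
    show "topspace (subtopology T H) = carrier (G\<lparr>carrier := H\<rparr>)"
      using sub by (auto simp: topspace_eq)
    have "continuous_map (prod_topology (subtopology T H) (subtopology T H)) T (\<lambda>p. fst p \<otimes> snd p)"
      by (intro continuous_map_mult continuous_map_into_fulltopology[OF continuous_map_fst]
          continuous_map_into_fulltopology[OF continuous_map_snd])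
    then show "continuous_map (prod_topology (subtopology T H) (subtopology T H)) (subtopology T H)
        (\<lambda>(x, y). x \<otimes>\<^bsub>G\<lparr>carrier := H\<rparr>\<^esub> y)"
      using assms by (auto simp: continuous_map_in_subtopology case_prod_unfold subgroup.m_closed)
    have "continuous_map (subtopology T H) T (\<lambda>x. inv x)"
      using continuous_inv by (rule continuous_map_from_subtopology)
    then have "continuous_map (subtopology T H) (subtopology T H) (\<lambda>x. inv x)"
      using assms by (auto simp: continuous_map_in_subtopology subgroup.m_inv_closed)
    then show "continuous_map (subtopology T H) (subtopology T H) (\<lambda>x. inv\<^bsub>G\<lparr>carrier := H\<rparr>\<^esub> x)"
      by (rule continuous_map_eq) (use assms in \<open>auto simp: m_inv_consistent\<close>)
    show "Hausdorff_space (subtopology T H)" using Hausdorff by (rule Hausdorff_space_subtopology)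
  qed
qed

end

lemma topological_comm_group_DirProd:
  assumes "topological_comm_group G S" and "topological_comm_group H T"
  shows "topological_comm_group (G \<times>\<times> H) (prod_topology S T)"
proof -
  interpret G: topological_comm_group G S by fact
  interpret H: topological_comm_group H T by fact
  interpret P: group "G \<times>\<times> H" by (rule DirProd_group) unfold_locales
  interpret P: comm_group "G \<times>\<times> H"
    by (rule P.group_comm_groupI) (auto simp: G.m_comm H.m_comm)
  show ?thesis
  proof
    show "topspace (prod_topology S T) = carrier (G \<times>\<times> H)"
      by (simp add: G.topspace_eq H.topspace_eq)
    have "continuous_map (prod_topology (prod_topology S T) (prod_topology S T)) (prod_topology S T)
        (\<lambda>p. (fst (fst p) \<otimes>\<^bsub>G\<^esub> fst (snd p), snd (fst p) \<otimes>\<^bsub>H\<^esub> snd (snd p)))"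
      unfolding continuous_map_pairwise o_def fst_conv snd_conv
      by (intro conjI G.continuous_map_mult H.continuous_map_mult
          continuous_map_compose[OF continuous_map_fst continuous_map_fst, unfolded o_def]
          continuous_map_compose[OF continuous_map_snd continuous_map_fst, unfolded o_def]
          continuous_map_compose[OF continuous_map_fst continuous_map_snd, unfolded o_def]
          continuous_map_compose[OF continuous_map_snd continuous_map_snd, unfolded o_def])
    then show "continuous_map (prod_topology (prod_topology S T) (prod_topology S T)) (prod_topology S T)
        (\<lambda>(x, y). x \<otimes>\<^bsub>G \<times>\<times> H\<^esub> y)"
      by (simp add: case_prod_unfold mult_DirProd')
    have "continuous_map (prod_topology S T) (prod_topology S T) (\<lambda>p. (inv\<^bsub>G\<^esub> (fst p), inv\<^bsub>H\<^esub> (snd p)))"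
      unfolding continuous_map_pairwise o_def fst_conv snd_conv
      using continuous_map_compose[OF continuous_map_fst G.continuous_inv]
        continuous_map_compose[OF continuous_map_snd H.continuous_inv]
      by (auto simp: o_def)
    then show "continuous_map (prod_topology S T) (prod_topology S T) (\<lambda>x. inv\<^bsub>G \<times>\<times> H\<^esub> x)"
      by (rule continuous_map_eq)
        (auto simp: G.topspace_eq H.topspace_eq inv_DirProd[OF G.is_group H.is_group])
    show "Hausdorff_space (prod_topology S T)"
      by (simp add: Hausdorff_space_prod_topology G.Hausdorff H.Hausdorff)
  qed
qed

section \<open>Directed intersections in compact sets\<close>

text \<open>The finite intersection property for families that are directed downwards: here it is enough that
  each single member meets the compact set.\<close>

lemma compactin_directed_Inter_nonempty:
  assumes K: "compactin S K" and ne: "\<C> \<noteq> {}"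
    and closed: "\<And>C. C \<in> \<C> \<Longrightarrow> closedin S C" and meets: "\<And>C. C \<in> \<C> \<Longrightarrow> K \<inter> C \<noteq> {}"
    and directed: "\<And>C C'. C \<in> \<C> \<Longrightarrow> C' \<in> \<C> \<Longrightarrow> \<exists>C''\<in>\<C>. C'' \<subseteq> C \<inter> C'"
  shows "K \<inter> \<Inter>\<C> \<noteq> {}"
proof
  assume empty: "K \<inter> \<Inter>\<C> = {}"
  have "K \<subseteq> topspace S" using K by (rule compactin_subset_topspace)
  then have "K \<subseteq> \<Union>((\<lambda>C. topspace S - C) ` \<C>)" using empty by blast
  then obtain \<F> where \<F>: "finite \<F>" "\<F> \<subseteq> (\<lambda>C. topspace S - C) ` \<C>" "K \<subseteq> \<Union>\<F>"
    using compactinD[OF K, of "(\<lambda>C. topspace S - C) ` \<C>"] closed by blast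
  then obtain F where F: "finite F" "F \<subseteq> \<C>" "\<F> = (\<lambda>C. topspace S - C) ` F"
    using finite_subset_image by metis
  have "\<exists>C\<in>\<C>. C \<subseteq> \<Inter>F" using F(1,2)
  proof (induction F)
    case empty
    then show ?case using ne by blast
  next
    case (insert A F)
    then obtain C where "C \<in> \<C>" "C \<subseteq> \<Inter>F" "A \<in> \<C>" by auto
    moreover from this obtain C'' where "C'' \<in> \<C>" "C'' \<subseteq> A \<inter> C" using directed by meson
    ultimately show ?case by blast
  qed
  then obtain C where "C \<in> \<C>" "C \<subseteq> \<Inter>F" by blast
  moreover have "K \<inter> \<Inter>F = {}" using \<F>(3) F(3) by auto
  ultimately show False using meets by blast
qed

section \<open>Profinite groups have small open subgroups\<close>

context topological_comm_group
begin

lemma openin_subgroup: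
  assumes H: "subgroup H G" and W: "openin T W" "\<one> \<in> W" "W \<subseteq> H"
  shows "openin T H"
proof (subst openin_subopen, intro ballI)
  fix x assume x: "x \<in> H"
  then have xc: "x \<in> carrier G" using H by (rule subgroup.mem_carrier[rotated])
  let ?A = "{y \<in> topspace T. inv x \<otimes> y \<in> W}"
  have "openin T ?A"
    using openin_continuous_map_preimage[OF continuous_map_translation W(1)] xc by simp
  moreover have "x \<in> ?A" using xc W by (simp add: topspace_eq)
  moreover have "?A \<subseteq> H"
  proof
    fix y assume "y \<in> ?A"
    then have y: "y \<in> carrier G" "inv x \<otimes> y \<in> H" using W by (auto simp: topspace_eq)
    then have "x \<otimes> (inv x \<otimes> y) \<in> H" using x H by (blast intro: subgroup.m_closed)
    then show "y \<in> H" using xc y by (simp add: m_assoc[symmetric])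
  qed
  ultimately show "\<exists>A. openin T A \<and> x \<in> A \<and> A \<subseteq> H" by blast
qed

text \<open>In a compact totally disconnected space the component of the identity is a point, so it has a clopen
  neighbourhood \<open>K\<close> inside \<open>U\<close>. Multiplication maps the compact set \<open>{\<one>} \<times> K\<close> into the open set \<open>K\<close>,
  so some neighbourhood of the identity maps \<open>K\<close> into itself. The stabiliser of \<open>K\<close> under translation
  is therefore an open subgroup, and it lies in \<open>K\<close> because \<open>K\<close> contains the identity.\<close>

lemma small_open_subgroup:
  assumes "compact_space T" "totally_disconnected_space T" and U: "openin T U" "\<one> \<in> U"
  obtains H where "subgroup H G" "openin T H" "H \<subseteq> U"
proof -
  let ?C = "connected_component_of_set T \<one>"
  have one: "\<one> \<in> topspace T" by (simp add: topspace_eq)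
  have "\<one> \<in> ?C" using one by (simp add: connected_component_of_refl)
  moreover have "connectedin T ?C" by (rule connectedin_connected_component_of)
  ultimately have C: "?C = {\<one>}"
    using assms(2) unfolding totally_disconnected_space_def by blast
  obtain K K' where K: "openin T K" "openin T K'" "disjnt K K'" "K \<union> K' = topspace T"
      "\<one> \<in> K" "K \<subseteq> U"
  proof (rule wilder_locally_compact_component_thm[of T ?C U])
    show "?C \<in> connected_components_of T" using one by (simp add: connected_components_of_def)
    show "compactin T ?C" "?C \<subseteq> U" using one U by (simp_all only: C) simp_all
  qed (use assms Hausdorff compact_imp_locally_compact_space C in auto)
  have "K = topspace T - K'" using K by (auto simp: disjnt_iff)
  then have "compactin T K"
    using K(2) assms(1) by (simp add: closedin_compact_space closedin_diff)
  let ?S = "{p \<in> topspace (prod_topology T T). (\<lambda>(x, y). x \<otimes> y) p \<in> K}"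
  have op: "openin (prod_topology T T) ?S"
    by (rule openin_continuous_map_preimage[OF continuous_mult K(1)])
  have sub: "{\<one>} \<times> K \<subseteq> ?S"
    using K openin_subset[OF K(1)] by (auto simp: topspace_eq)
  have "compactin T {\<one>}" using one by simp
  obtain V B where V: "openin T V" "openin T B" "{\<one>} \<subseteq> V" "K \<subseteq> B" "V \<times> B \<subseteq> ?S"
    by (rule Wallace_theorem_prod_topology[OF \<open>compactin T {\<one>}\<close> \<open>compactin T K\<close> op sub])
  have VK: "v \<otimes> k \<in> K" if "v \<in> V" "k \<in> K" for v k using subsetD[OF V(5), of "(v, k)"] V(4) that by auto
  define H where "H = {x \<in> carrier G. \<forall>k\<in>K. x \<otimes> k \<in> K \<and> inv x \<otimes> k \<in> K}"
  have Kc: "K \<subseteq> carrier G" using openin_subset[OF K(1)] by (simp add: topspace_eq)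
  have H: "subgroup H G"
  proof
    show "H \<subseteq> carrier G" "\<one> \<in> H" using Kc by (auto simp: H_def)
    show "inv x \<in> H" if "x \<in> H" for x using that by (auto simp: H_def)
    show "x \<otimes> y \<in> H" if "x \<in> H" "y \<in> H" for x y
      using that Kc by (auto simp: H_def m_assoc inv_mult subset_iff)
  qed
  moreover have "openin T H"
  proof (rule openin_subgroup[OF H])
    let ?W = "V \<inter> {x \<in> topspace T. inv x \<in> V}"
    show "openin T ?W" using V openin_continuous_map_preimage[OF continuous_inv] by blast
    show "\<one> \<in> ?W" using V one by simp
    show "?W \<subseteq> H" using VK by (auto simp: H_def topspace_eq)
  qed
  moreover have "H \<subseteq> U" 
  proof
    fix x assume "x \<in> H"
    then have "x \<otimes> \<one> \<in> K" "x \<in> carrier G" using K by (auto simp: H_def)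
    then show "x \<in> U" using K by auto
  qed
  ultimately show thesis by (rule that)
qed

end

section \<open>Tori have no small subgroups\<close>

lemma real_group_simps [simp]:
  "carrier real_group = UNIV" "x \<otimes>\<^bsub>real_group\<^esub> y = x + y" "\<one>\<^bsub>real_group\<^esub> = 0"
  by (simp_all add: real_group_def)

lemma comm_group_real_group: "comm_group real_group"
proof (rule comm_groupI)
  show "\<exists>y\<in>carrier real_group. y \<otimes>\<^bsub>real_group\<^esub> x = \<one>\<^bsub>real_group\<^esub>" for x
    by (auto intro: exI[of _ "-x"])
qed auto

interpretation real_group: comm_group real_group
  by (rule comm_group_real_group)

lemma inv_real_group [simp]: "inv\<^bsub>real_group\<^esub> x = - x"
  by (rule real_group.inv_equality) auto

lemma subgroup_Ints: "subgroup \<int> real_group"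
  by (rule real_group.subgroupI) auto

interpretation Ints: normal \<int> real_group
  using subgroup_Ints by (rule real_group.subgroup_imp_normal)

lemma Ints_coset_eq_iff: "\<int> #>\<^bsub>real_group\<^esub> x = \<int> #>\<^bsub>real_group\<^esub> y \<longleftrightarrow> x - y \<in> \<int>"
proof
  assume "\<int> #>\<^bsub>real_group\<^esub> x = \<int> #>\<^bsub>real_group\<^esub> y"
  then have "x \<in> \<int> #>\<^bsub>real_group\<^esub> y"
    using real_group.rcos_self[OF _ subgroup_Ints, of x] by simp
  then show "x - y \<in> \<int>" by (auto simp: r_coset_def)
next
  assume "x - y \<in> \<int>"
  then have "(x - y) + y \<in> \<int> #>\<^bsub>real_group\<^esub> y" unfolding r_coset_def by force
  then have "x \<in> \<int> #>\<^bsub>real_group\<^esub> y" by simp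
  then show "\<int> #>\<^bsub>real_group\<^esub> x = \<int> #>\<^bsub>real_group\<^esub> y"
    using real_group.repr_independence[OF _ _ subgroup_Ints] by simp
qed

lemma Ints_coset_zero: "\<int> #>\<^bsub>real_group\<^esub> 0 = \<int>"
  using real_group.coset_join2[OF _ subgroup_Ints, of 0] by simp

lemma Ints_coset_mult:
  "(\<int> #>\<^bsub>real_group\<^esub> x) <#>\<^bsub>real_group\<^esub> (\<int> #>\<^bsub>real_group\<^esub> y) = \<int> #>\<^bsub>real_group\<^esub> (x + y)"
  using Ints.rcos_sum[of x y] by simp

text \<open>If \<open>x\<close> is a representative of absolute value less than \<open>1/3\<close> and all multiples of its class stay
  within the arc of radius \<open>1/3\<close>, then all multiples of \<open>x\<close> itself stay below \<open>1/3\<close>: passing from one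
  multiple to the next cannot bridge the gap to a neighbouring arc. Hence \<open>x = 0\<close>.\<close>

lemma circle_no_small_submonoid:
  assumes mult: "\<And>a b. a \<in> H \<Longrightarrow> b \<in> H \<Longrightarrow> a <#>\<^bsub>real_group\<^esub> b \<in> H"
    and small: "H \<subseteq> (\<lambda>x. \<int> #>\<^bsub>real_group\<^esub> x) ` {-1/3<..<1/3}"
  shows "H \<subseteq> {\<int>}"
proof
  fix h assume "h \<in> H"
  then obtain x where x: "h = \<int> #>\<^bsub>real_group\<^esub> x" "\<bar>x\<bar> < 1/3" using small by fastforce
  have "\<int> #>\<^bsub>real_group\<^esub> (real (Suc n) * x) \<in> H \<and> \<bar>real (Suc n) * x\<bar> < 1/3" for n
  proof (induction n)
    case 0
    then show ?case using x \<open>h \<in> H\<close> by simp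
  next
    case (Suc n)
    let ?z = "real (Suc n) * x + x"
    have "\<int> #>\<^bsub>real_group\<^esub> ?z \<in> H"
      using mult[of "\<int> #>\<^bsub>real_group\<^esub> (real (Suc n) * x)" h] Suc x \<open>h \<in> H\<close>
      by (simp add: Ints_coset_mult)
    moreover from this obtain y where y: "\<int> #>\<^bsub>real_group\<^esub> ?z = \<int> #>\<^bsub>real_group\<^esub> y" "\<bar>y\<bar> < 1/3"
      using small by fastforce
    then have "?z - y \<in> \<int>" by (simp only: Ints_coset_eq_iff)
    \<comment> \<open>three terms below 1/3 each, so the integer vanishes\<close>
    moreover have "\<bar>?z - y\<bar> < 1" using Suc x y by linarith
    ultimately have "?z = y" using Ints_nonzero_abs_less1 by force
    moreover have "?z = real (Suc (Suc n)) * x" by (simp add: algebra_simps)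
    ultimately show ?case using \<open>\<int> #>\<^bsub>real_group\<^esub> ?z \<in> H\<close> y by simp
  qed
  then have "real (Suc n) * \<bar>x\<bar> < 1/3" for n by (simp add: abs_mult)
  then have small_multiples: "real n * \<bar>x\<bar> < 1/3" for n by (cases n) auto
  have "x = 0"
  proof (rule ccontr)
    assume "x \<noteq> 0"
    then obtain n where "1/3 < real n * \<bar>x\<bar>" using reals_Archimedean3[of "\<bar>x\<bar>"] by (meson zero_less_abs_iff)
    then show False using small_multiples[of n] by simp
  qed
  then show "h \<in> {\<int>}" using x by (simp add: Ints_coset_zero)
qed

lemma openin_circle_arc:
  "openin (coset_topology real_group euclideanreal \<int>) ((\<lambda>x. \<int> #>\<^bsub>real_group\<^esub> x) ` {-1/3<..<1/3})"
proof -
  have "{x. \<int> #>\<^bsub>real_group\<^esub> x \<in> (\<lambda>x. \<int> #>\<^bsub>real_group\<^esub> x) ` {-1/3<..<1/3}} =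
      (\<Union>n. {real_of_int n - 1/3<..<real_of_int n + 1/3})" (is "?A = ?B")
  proof (intro equalityI subsetI)
    fix x assume "x \<in> ?A"
    then obtain y where y: "\<int> #>\<^bsub>real_group\<^esub> x = \<int> #>\<^bsub>real_group\<^esub> y" "y \<in> {-1/3<..<1/3}" by blast
    then obtain n where "x - y = of_int n" unfolding Ints_coset_eq_iff by (auto elim: Ints_cases)
    then show "x \<in> ?B" using y by (intro UN_I[of n]) auto
  next
    fix x assume "x \<in> ?B"
    then obtain n where n: "x \<in> {real_of_int n - 1/3<..<real_of_int n + 1/3}" by blast
    have "\<int> #>\<^bsub>real_group\<^esub> x = \<int> #>\<^bsub>real_group\<^esub> (x - of_int n)" by (simp add: Ints_coset_eq_iff)
    then show "x \<in> ?A" using n by (intro CollectI image_eqI) auto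
  qed
  then show ?thesis
    unfolding coset_topology_def openin_quotient_topology by (auto intro!: open_UN)
qed

lemma group_torus_group: "group (torus_group k)"
  unfolding torus_group_def by (intro product_group Ints.factorgroup_is_group)

lemma torus_no_small_subgroups:
  obtains W where "openin (torus_topology k) W" "\<one>\<^bsub>torus_group k\<^esub> \<in> W"
    "\<And>H. subgroup H (torus_group k) \<Longrightarrow> H \<subseteq> W \<Longrightarrow> H \<subseteq> {\<one>\<^bsub>torus_group k\<^esub>}"
proof
  let ?A = "(\<lambda>x. \<int> #>\<^bsub>real_group\<^esub> x) ` {-1/3<..<1/3}"
  let ?W = "Pi\<^sub>E {..<k} (\<lambda>_. ?A)"
  show "openin (torus_topology k) ?W"
    unfolding torus_topology_def using openin_circle_arc by (simp add: openin_PiE)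
  have "\<int> \<in> ?A" by (rule image_eqI[of _ _ 0]) (auto simp: Ints_coset_zero)
  then show "\<one>\<^bsub>torus_group k\<^esub> \<in> ?W" by (auto simp: torus_group_def)
  fix H assume H: "subgroup H (torus_group k)" "H \<subseteq> ?W"
  have coord: "(\<lambda>h. h i) ` H \<subseteq> {\<int>}" if "i < k" for i
  proof (rule circle_no_small_submonoid)
    fix a b assume "a \<in> (\<lambda>h. h i) ` H" "b \<in> (\<lambda>h. h i) ` H"
    then obtain g h where gh: "g \<in> H" "h \<in> H" "a = g i" "b = h i" by blast
    then have "g \<otimes>\<^bsub>torus_group k\<^esub> h \<in> H" using H by (blast intro: subgroup.m_closed)
    moreover have "a <#>\<^bsub>real_group\<^esub> b = (g \<otimes>\<^bsub>torus_group k\<^esub> h) i"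
      using gh that by (simp add: torus_group_def)
    ultimately show "a <#>\<^bsub>real_group\<^esub> b \<in> (\<lambda>h. h i) ` H" by (intro image_eqI[of _ "\<lambda>h. h i"])
  qed (use H that in \<open>auto simp: PiE_iff\<close>)
  show "H \<subseteq> {\<one>\<^bsub>torus_group k\<^esub>}"
  proof
    fix h assume h: "h \<in> H"
    then have "h \<in> extensional {..<k}" using H by (auto simp: PiE_iff)
    moreover have "h i = \<int>" if "i < k" for i using coord[OF that] h by blast
    ultimately show "h \<in> {\<one>\<^bsub>torus_group k\<^esub>}"
      by (auto simp: torus_group_def fun_eq_iff extensional_def)
  qed
qed

context topological_comm_group
begin

lemma profinite_latticeD:
  assumes "\<Delta> \<in> profinite_lattice G T"
  shows "subgroup \<Delta> G" "compactin T \<Delta>" "closedin T \<Delta>"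
    "totally_disconnected_space (subtopology T \<Delta>)" "compact_space (subtopology T \<Delta>)"
proof -
  show s: "subgroup \<Delta> G" and c: "compact_space (subtopology T \<Delta>)"
    and "totally_disconnected_space (subtopology T \<Delta>)"
    using assms by (auto simp: profinite_lattice_def profinite_subgroup_def)
  show k: "compactin T \<Delta>" using subgroup.subset[OF s] c by (simp add: compactin_subspace topspace_eq)
  show "closedin T \<Delta>" using k Hausdorff by (rule compactin_imp_closedin[rotated])
qed

text \<open>The quotient map followed by an identification of \<open>G/\<Delta>\<close> with a standard torus pulls back the
  neighbourhood without nontrivial subgroups.\<close>

lemma small_subgroups_in_torus_kernel:
  assumes "\<Delta> \<in> profinite_lattice G T"
  obtains U where "openin T U" "\<one> \<in> U" "\<And>H. subgroup H G \<Longrightarrow> H \<subseteq> U \<Longrightarrow> H \<subseteq> \<Delta>"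
proof -
  have D: "subgroup \<Delta> G" using assms by (rule profinite_latticeD)
  interpret D: normal \<Delta> G using D by (rule subgroup_imp_normal)
  obtain k f where f: "f \<in> iso (G Mod \<Delta>) (torus_group k)"
      and hf: "homeomorphic_map (coset_topology G T \<Delta>) (torus_topology k) f"
    using assms by (auto simp: profinite_lattice_def is_torus_def topgroup_isomorphic_def)
  define p where "p = f \<circ> (\<lambda>x. \<Delta> #> x)"
  have ph: "p \<in> hom G (torus_group k)"
    unfolding p_def using D.r_coset_hom_Mod f by (auto simp: iso_def intro: Group.hom_compose)
  interpret p: group_hom G "torus_group k" p
    by (intro group_hom.intro group_hom_axioms.intro group_torus_group ph is_group)
  have pc: "continuous_map T (torus_topology k) p"
    unfolding p_def using hf quotient_map_quotient_topology
    by (intro continuous_map_compose)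
      (auto simp: coset_topology_def intro: quotient_imp_continuous_map homeomorphic_imp_continuous_map)
  have ker: "x \<in> \<Delta>" if x: "x \<in> carrier G" "p x = \<one>\<^bsub>torus_group k\<^esub>" for x
  proof -
    have "\<Delta> #> \<one> = \<Delta>" using D by (simp add: coset_join2 subgroup.one_closed)
    then have "f (\<Delta> #> x) = f \<Delta>" using x p.hom_one by (simp add: p_def)
    moreover have "\<Delta> #> x \<in> carrier (G Mod \<Delta>)" "\<Delta> \<in> carrier (G Mod \<Delta>)"
      using x \<open>\<Delta> #> \<one> = \<Delta>\<close> by (force simp: carrier_FactGroup)+
    ultimately have "\<Delta> #> x = \<Delta>" using f by (auto simp: iso_def bij_betw_def inj_on_def)
    then show ?thesis using rcos_self[OF x(1) D] by simp
  qed
  obtain W where W: "openin (torus_topology k) W" "\<one>\<^bsub>torus_group k\<^esub> \<in> W"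
    "\<And>H. subgroup H (torus_group k) \<Longrightarrow> H \<subseteq> W \<Longrightarrow> H \<subseteq> {\<one>\<^bsub>torus_group k\<^esub>}"
    using torus_no_small_subgroups by blast
  show thesis
  proof
    show "openin T {x \<in> topspace T. p x \<in> W}"
      by (rule openin_continuous_map_preimage[OF pc W(1)])
    show "\<one> \<in> {x \<in> topspace T. p x \<in> W}" using W by (simp add: topspace_eq)
    fix H assume H: "subgroup H G" "H \<subseteq> {x \<in> topspace T. p x \<in> W}"
    then have "p ` H \<subseteq> {\<one>\<^bsub>torus_group k\<^esub>}"
      by (intro W(3) p.subgroup_img_is_subgroup) auto
    then show "H \<subseteq> \<Delta>" using ker subgroup.subset[OF H(1)] by blast
  qed
qed

text \<open>An open subgroup of \<open>\<Delta>\<close> that is small enough vanishes in the torus \<open>G/\<Delta>'\<close>, so it is contained in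
  \<open>\<Delta> \<inter> \<Delta>'\<close>.\<close>

lemma profinite_lattice_commensurable:
  assumes "\<Delta> \<in> profinite_lattice G T" "\<Delta>' \<in> profinite_lattice G T"
  shows "openin (subtopology T \<Delta>) (\<Delta> \<inter> \<Delta>')"
proof -
  note D = profinite_latticeD[OF assms(1)] and D' = profinite_latticeD[OF assms(2)]
  interpret D: topological_comm_group "G\<lparr>carrier := \<Delta>\<rparr>" "subtopology T \<Delta>"
    by (rule subgroup_topological_comm_group[OF D(1)])
  obtain U where U: "openin T U" "\<one> \<in> U" "\<And>H. subgroup H G \<Longrightarrow> H \<subseteq> U \<Longrightarrow> H \<subseteq> \<Delta>'"
    using small_subgroups_in_torus_kernel[OF assms(2)] by blast
  have "openin (subtopology T \<Delta>) (U \<inter> \<Delta>)" "\<one>\<^bsub>G\<lparr>carrier := \<Delta>\<rparr>\<^esub> \<in> U \<inter> \<Delta>"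
    using U D(1) by (auto simp: openin_subtopology subgroup.one_closed)
  then obtain H where H: "subgroup H (G\<lparr>carrier := \<Delta>\<rparr>)" "openin (subtopology T \<Delta>) H" "H \<subseteq> U \<inter> \<Delta>"
    using D.small_open_subgroup[OF D(5) D(4)] by metis
  have "subgroup H G" using incl_subgroup[OF D(1) H(1)] .
  then have "H \<subseteq> \<Delta>'" using U H by blast
  show ?thesis
  proof (rule D.openin_subgroup)
    show "subgroup (\<Delta> \<inter> \<Delta>') (G\<lparr>carrier := \<Delta>\<rparr>)"
      using subgroups_Inter_pair[OF D(1) D'(1)] D(1) by (intro subgroup_incl) auto
    show "openin (subtopology T \<Delta>) H" "H \<subseteq> \<Delta> \<inter> \<Delta>'" "\<one>\<^bsub>G\<lparr>carrier := \<Delta>\<rparr>\<^esub> \<in> H"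
      using H \<open>H \<subseteq> \<Delta>'\<close> subgroup.one_closed[OF H(1)] by auto
  qed
qed

end

section \<open>The ring of profinite integers\<close>

lemma Zhat_simps:
  "x \<otimes>\<^bsub>Zhat\<^esub> y = (\<lambda>n\<in>{1..}. (x n * y n) mod int n)"
  "x \<oplus>\<^bsub>Zhat\<^esub> y = (\<lambda>n\<in>{1..}. (x n + y n) mod int n)"
  "\<one>\<^bsub>Zhat\<^esub> = (\<lambda>n\<in>{1..}. 1 mod int n)"
  "\<zero>\<^bsub>Zhat\<^esub> = (\<lambda>n\<in>{1..}. 0)"
  by (simp_all add: Zhat_def)

lemma Zhat_memI:
  assumes "\<And>n. n \<ge> 1 \<Longrightarrow> x n mod int n = x n"
    and "\<And>m n. m \<ge> 1 \<Longrightarrow> n \<ge> 1 \<Longrightarrow> m dvd n \<Longrightarrow> x n mod int m = x m mod int m"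
    and "x \<in> extensional {1..}"
  shows "x \<in> carrier Zhat"
proof -
  have "x n \<in> {0..<int n}" if "n \<ge> 1" for n
    using assms(1)[OF that] that pos_mod_bound[of "int n" "x n"] pos_mod_sign[of "int n" "x n"] by simp
  then show ?thesis using assms by (auto simp: Zhat_def PiE_iff)
qed

lemma
  assumes "x \<in> carrier Zhat" and "n \<ge> 1"
  shows Zhat_range: "x n \<in> {0..<int n}"
    and Zhat_mod_self: "x n mod int n = x n"
    and Zhat_compat: "m \<ge> 1 \<Longrightarrow> m dvd n \<Longrightarrow> x n mod int m = x m"
  using assms by (auto simp: Zhat_def PiE_iff)

lemma Zhat_extensional: "x \<in> carrier Zhat \<Longrightarrow> x \<in> extensional {1..}"
  by (auto simp: Zhat_def PiE_iff)

lemma Zhat_eqI: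
  assumes "x \<in> extensional {1..}" "y \<in> extensional {1..}" "\<And>n. n \<ge> 1 \<Longrightarrow> x n = y n"
  shows "x = y"
  using assms by (auto intro: extensionalityI[of _ "{1..}"])

text \<open>The canonical ring homomorphism from the integers.\<close>

definition int_to_Zhat :: "int \<Rightarrow> nat \<Rightarrow> int" where
  "int_to_Zhat k = (\<lambda>n\<in>{1..}. k mod int n)"

lemma int_to_Zhat_closed: "int_to_Zhat k \<in> carrier Zhat"
  by (rule Zhat_memI) (auto simp: int_to_Zhat_def mod_mod_cancel)

lemma Zhat_add_closed:
  assumes "x \<in> carrier Zhat" "y \<in> carrier Zhat"
  shows "x \<oplus>\<^bsub>Zhat\<^esub> y \<in> carrier Zhat"
proof (rule Zhat_memI)
  fix m n :: nat assume mn: "m \<ge> 1" "n \<ge> 1" "m dvd n"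
  have "((x n + y n) mod int n) mod int m = (x n mod int m + y n mod int m) mod int m"
    using mn by (simp add: mod_mod_cancel mod_add_eq)
  then show "(x \<oplus>\<^bsub>Zhat\<^esub> y) n mod int m = (x \<oplus>\<^bsub>Zhat\<^esub> y) m mod int m"
    using mn assms by (simp add: Zhat_simps Zhat_compat)
qed (auto simp: Zhat_simps)

lemma Zhat_mult_closed:
  assumes "x \<in> carrier Zhat" "y \<in> carrier Zhat"
  shows "x \<otimes>\<^bsub>Zhat\<^esub> y \<in> carrier Zhat"
proof (rule Zhat_memI)
  fix m n :: nat assume mn: "m \<ge> 1" "n \<ge> 1" "m dvd n"
  have "((x n * y n) mod int n) mod int m = ((x n mod int m) * (y n mod int m)) mod int m"
    using mn by (simp add: mod_mod_cancel mod_mult_eq)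
  then show "(x \<otimes>\<^bsub>Zhat\<^esub> y) n mod int m = (x \<otimes>\<^bsub>Zhat\<^esub> y) m mod int m"
    using mn assms by (simp add: Zhat_simps Zhat_compat)
qed (auto simp: Zhat_simps)

lemma Zhat_uminus_closed:
  assumes "x \<in> carrier Zhat"
  shows "(\<lambda>n\<in>{1..}. (- x n) mod int n) \<in> carrier Zhat"
proof (rule Zhat_memI)
  fix m n :: nat assume mn: "m \<ge> 1" "n \<ge> 1" "m dvd n"
  have "((- x n) mod int n) mod int m = (- (x n mod int m)) mod int m"
    using mn by (simp add: mod_mod_cancel mod_minus_eq)
  then show "(\<lambda>n\<in>{1..}. (- x n) mod int n) n mod int m = (\<lambda>n\<in>{1..}. (- x n) mod int n) m mod int m"
    using mn assms by (simp add: Zhat_compat)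
qed auto

lemma cring_Zhat: "cring Zhat"
proof (rule cringI)
  note closed = Zhat_add_closed[unfolded Zhat_simps] Zhat_mult_closed[unfolded Zhat_simps]
  have zero: "\<zero>\<^bsub>Zhat\<^esub> = int_to_Zhat 0" and one: "\<one>\<^bsub>Zhat\<^esub> = int_to_Zhat 1"
    by (simp_all add: Zhat_simps int_to_Zhat_def)
  show "abelian_group Zhat"
  proof (rule abelian_groupI)
    show "\<zero>\<^bsub>Zhat\<^esub> \<in> carrier Zhat" by (simp only: zero int_to_Zhat_closed)
    fix x assume x: "x \<in> carrier Zhat"
    show "\<zero>\<^bsub>Zhat\<^esub> \<oplus>\<^bsub>Zhat\<^esub> x = x"
      using Zhat_extensional[OF x] Zhat_mod_self[OF x]
      by (intro Zhat_eqI) (simp_all add: Zhat_simps del: One_nat_def)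
    show "\<exists>y\<in>carrier Zhat. y \<oplus>\<^bsub>Zhat\<^esub> x = \<zero>\<^bsub>Zhat\<^esub>"
      using x by (intro bexI[of _ "\<lambda>n\<in>{1..}. (- x n) mod int n"] Zhat_uminus_closed)
        (auto simp: Zhat_simps fun_eq_iff mod_simps)
  next
    fix x y z assume "x \<in> carrier Zhat" "y \<in> carrier Zhat" "z \<in> carrier Zhat"
    then show "x \<oplus>\<^bsub>Zhat\<^esub> y \<oplus>\<^bsub>Zhat\<^esub> z = x \<oplus>\<^bsub>Zhat\<^esub> (y \<oplus>\<^bsub>Zhat\<^esub> z)"
      by (auto simp: Zhat_simps fun_eq_iff mod_simps add.assoc)
  qed (use closed in \<open>auto simp: Zhat_simps fun_eq_iff add.commute simp del: One_nat_def\<close>)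
  show "comm_monoid Zhat"
  proof (rule comm_monoidI)
    show "\<one>\<^bsub>Zhat\<^esub> \<in> carrier Zhat" by (simp only: one int_to_Zhat_closed)
    fix x assume x: "x \<in> carrier Zhat"
    show "\<one>\<^bsub>Zhat\<^esub> \<otimes>\<^bsub>Zhat\<^esub> x = x"
      using Zhat_extensional[OF x] Zhat_mod_self[OF x]
      by (intro Zhat_eqI) (simp_all add: Zhat_simps mod_simps del: One_nat_def)
  next
    fix x y z assume "x \<in> carrier Zhat" "y \<in> carrier Zhat" "z \<in> carrier Zhat"
    then show "x \<otimes>\<^bsub>Zhat\<^esub> y \<otimes>\<^bsub>Zhat\<^esub> z = x \<otimes>\<^bsub>Zhat\<^esub> (y \<otimes>\<^bsub>Zhat\<^esub> z)"
      by (auto simp: Zhat_simps fun_eq_iff mod_simps mult.assoc)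
  qed (use closed in \<open>auto simp: Zhat_simps fun_eq_iff mult.commute simp del: One_nat_def\<close>)
  fix x y z assume "x \<in> carrier Zhat" "y \<in> carrier Zhat" "z \<in> carrier Zhat"
  then show "(x \<oplus>\<^bsub>Zhat\<^esub> y) \<otimes>\<^bsub>Zhat\<^esub> z = x \<otimes>\<^bsub>Zhat\<^esub> z \<oplus>\<^bsub>Zhat\<^esub> y \<otimes>\<^bsub>Zhat\<^esub> z"
    by (auto simp: Zhat_simps fun_eq_iff mod_simps algebra_simps)
qed

lemma topspace_Zhat_topology: "topspace Zhat_topology = carrier Zhat"
proof -
  have "carrier Zhat \<subseteq> (\<Pi>\<^sub>E n\<in>{1..}. {0..<int n})" by (auto simp: Zhat_def)
  then show ?thesis by (auto simp: Zhat_topology_def)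
qed

lemma continuous_map_Zhat_coordinate:
  assumes "n \<ge> 1"
  shows "continuous_map Zhat_topology (discrete_topology {0..<int n}) (\<lambda>z. z n)"
  unfolding Zhat_topology_def
  using continuous_map_product_projection[of n "{1..}" "\<lambda>n. discrete_topology {0..<int n}"] assms
  by (auto intro: continuous_map_from_subtopology)

text \<open>The profinite integers are cut out of the compact product of the finite sets \<open>{0..<n}\<close> by conditions
  on two coordinates at a time, and such conditions are closed for discrete factors.\<close>

lemma compact_space_Zhat_topology: "compact_space Zhat_topology"
proof -
  let ?P = "product_topology (\<lambda>n. discrete_topology {0..<int n}) {1..}"
  have coord: "continuous_map ?P (discrete_topology {0..<int n}) (\<lambda>z. z n)" if "n \<ge> 1" for n
    using continuous_map_product_projection[of n "{1..}" "\<lambda>n. discrete_topology {0..<int n}"] that by simp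
  have rel: "closedin ?P {x \<in> topspace ?P. x n mod int m = x m}" if "m \<ge> 1" "n \<ge> 1" for m n
  proof -
    have "continuous_map ?P (prod_topology (discrete_topology {0..<int n}) (discrete_topology {0..<int m})) (\<lambda>x. (x n, x m))"
      using coord that by (auto simp: continuous_map_pairwise o_def)
    then have "closedin ?P {x \<in> topspace ?P. (x n, x m) \<in> {p \<in> {0..<int n} \<times> {0..<int m}. fst p mod int m = snd p}}"
      by (rule closedin_continuous_map_preimage) (auto simp: prod_topology_discrete_topology[symmetric])
    moreover have "{x \<in> topspace ?P. (x n, x m) \<in> {p \<in> {0..<int n} \<times> {0..<int m}. fst p mod int m = snd p}}
        = {x \<in> topspace ?P. x n mod int m = x m}"
      using that by (force simp: PiE_iff)
    ultimately show ?thesis by simp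
  qed
  have "carrier Zhat = \<Inter>((\<lambda>(m, n). {x \<in> topspace ?P. x n mod int m = x m}) ` {(m, n). m \<ge> 1 \<and> n \<ge> 1 \<and> m dvd n})"
    by (auto simp: Zhat_def)
  moreover have "closedin ?P \<dots>"
    using rel by (intro closedin_Inter) (auto intro: exI[of _ 1])
  ultimately have "closedin ?P (carrier Zhat)" by simp
  moreover have "compact_space ?P"
    unfolding compact_space_product_topology by (simp add: compact_space_discrete_topology)
  ultimately show ?thesis
    unfolding Zhat_topology_def by (simp add: closedin_compact_space compact_space_subtopology)
qed

section \<open>The group generated by the lattice\<close>

locale profinite_lattice_group = topological_comm_group G T for G (structure) and T +
  fixes L :: "'a set set"
  assumes sublattice: "profinite_sublattice G T L"
    and Inter_trivial: "\<Inter>L = {\<one>}"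
begin

abbreviation "D \<equiv> Delta_hat G L"
abbreviation "TD \<equiv> Delta_hat_topology G L"

lemma
  shows L_nonempty: "L \<noteq> {}"
    and L_lattice: "\<Delta> \<in> L \<Longrightarrow> \<Delta> \<in> profinite_lattice G T"
    and L_join: "\<Delta> \<in> L \<Longrightarrow> \<Delta>' \<in> L \<Longrightarrow> \<Delta> <#> \<Delta>' \<in> L"
    and L_meet: "\<Delta> \<in> L \<Longrightarrow> \<Delta>' \<in> L \<Longrightarrow> \<Delta> \<inter> \<Delta>' \<in> L"
  using sublattice by (auto simp: profinite_sublattice_def)

lemmas L_subgroup = profinite_latticeD(1)[OF L_lattice]
  and L_closedin = profinite_latticeD(3)[OF L_lattice]
  and L_compact_space = profinite_latticeD(5)[OF L_lattice]

lemma L_subset_carrier: "\<Delta> \<in> L \<Longrightarrow> \<Delta> \<subseteq> carrier G"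
  using L_subgroup subgroup.subset by blast

text \<open>The union is already a group, because any two members of \<open>L\<close> lie in a common one, their join.\<close>

lemma generate_L: "generate G (\<Union>L) = \<Union>L"
proof (rule generateI[symmetric])
  show "subgroup (\<Union>L) G"
  proof (rule subgroupI)
    show "\<Union>L \<subseteq> carrier G" using L_subset_carrier by blast
    obtain \<Delta> where "\<Delta> \<in> L" using L_nonempty by blast
    then show "\<Union>L \<noteq> {}" using subgroup.one_closed[OF L_subgroup] by blast
    show "inv a \<in> \<Union>L" if "a \<in> \<Union>L" for a
    proof -
      obtain \<Delta> where \<Delta>: "a \<in> \<Delta>" "\<Delta> \<in> L" using \<open>a \<in> \<Union>L\<close> by blast
      then show ?thesis using subgroup.m_inv_closed[OF L_subgroup[OF \<Delta>(2)] \<Delta>(1)] by blast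
    qed
    show "a \<otimes> b \<in> \<Union>L" if "a \<in> \<Union>L" "b \<in> \<Union>L" for a b
    proof -
      obtain \<Delta> \<Delta>' where "a \<in> \<Delta>" "\<Delta> \<in> L" "b \<in> \<Delta>'" "\<Delta>' \<in> L"
        using \<open>a \<in> \<Union>L\<close> \<open>b \<in> \<Union>L\<close> by blast
      then have "a \<otimes> b \<in> \<Delta> <#> \<Delta>'" unfolding set_mult_def by blast
      then show ?thesis by (rule UnionI[OF L_join[OF \<open>\<Delta> \<in> L\<close> \<open>\<Delta>' \<in> L\<close>]])
    qed
  qed
qed auto

lemma carrier_D: "carrier D = \<Union>L"
  by (simp add: Delta_hat_def generate_L)

lemma subgroup_D: "subgroup (\<Union>L) G"
  using generate_is_subgroup[of "\<Union>L"] L_subset_carrier by (auto simp: generate_L Sup_le_iff)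

lemma D_eq: "D = G\<lparr>carrier := \<Union>L\<rparr>"
  by (simp add: Delta_hat_def generate_L)

lemma D_simps [simp]: "x \<otimes>\<^bsub>D\<^esub> y = x \<otimes> y" "\<one>\<^bsub>D\<^esub> = \<one>"
  by (simp_all add: D_eq)

lemma comm_group_D: "comm_group D"
  using subgroup_topological_comm_group[OF subgroup_D] by (simp add: D_eq topological_comm_group_def)

lemma basis_at_identity_D: "basis_at_identity D TD L"
proof -
  interpret D: comm_group D by (rule comm_group_D)
  have simps: "x <#\<^bsub>D\<^esub> N = x <# N" "M <#>\<^bsub>D\<^esub> N = M <#> N" for x M N
    by (auto simp: l_coset_def set_mult_def D_eq)
  have invD: "inv\<^bsub>D\<^esub> x = inv x" if "x \<in> carrier D" for x
    using m_inv_consistent[OF subgroup_D, of x] that by (simp add: D_eq)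
  show ?thesis
  proof
    fix N assume N: "N \<in> L"
    have "N <#>\<^bsub>D\<^esub> N \<subseteq> N"
      unfolding simps using subgroup.m_closed[OF L_subgroup[OF N]] by (auto simp: set_mult_def)
    then show "\<exists>M\<in>L. M <#>\<^bsub>D\<^esub> M \<subseteq> N" using N by blast
    have "inv\<^bsub>D\<^esub> x \<in> N" if "x \<in> N" for x
    proof -
      have "x \<in> carrier D" using that N by (auto simp: carrier_D)
      then show ?thesis using subgroup.m_inv_closed[OF L_subgroup[OF N] that] by (simp add: invD)
    qed
    then show "\<exists>M\<in>L. \<forall>x\<in>M. inv\<^bsub>D\<^esub> x \<in> N" using N by blast
    show "\<one>\<^bsub>D\<^esub> \<in> N" using subgroup.one_closed[OF L_subgroup[OF N]] by (simp add: D_eq)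
  qed (auto simp: openin_Delta_hat_topology[OF L_meet] simps L_nonempty carrier_D)
qed

sublocale D: basis_at_identity D TD L
  by (rule basis_at_identity_D)

lemma inv_D: "x \<in> carrier D \<Longrightarrow> inv\<^bsub>D\<^esub> x = inv x"
  using m_inv_consistent[OF subgroup_D, of x] by (simp add: D_eq)

lemma carrier_D_subset: "carrier D \<subseteq> carrier G"
  using L_subset_carrier by (auto simp: carrier_D)

lemma in_l_coset_D_iff:
  assumes "x \<in> carrier D" "\<Delta> \<in> L"
  shows "y \<in> x <#\<^bsub>D\<^esub> \<Delta> \<longleftrightarrow> y \<in> carrier D \<and> inv x \<otimes> y \<in> \<Delta>"
  using D.in_l_coset_iff[OF assms(1) D.basis_subset[OF assms(2)], of y] assms by (simp add: inv_D)

lemma topological_comm_group_D: "topological_comm_group D TD"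
  by (rule D.topological_comm_group_basis) (simp add: Inter_trivial)

lemma topspace_TD: "topspace TD = \<Union>L"
  using D.topspace_eq_carrier by (simp add: carrier_D)

lemma openin_TD: "\<Delta> \<in> L \<Longrightarrow> openin TD \<Delta>"
  using Delta_hat_topology_neighbourhood_basis(2)[OF is_group sublattice] by blast

text \<open>By commensurability each coset of a member of \<open>L\<close> meets \<open>\<Delta>\<close> in a set that is open in \<open>\<Delta>\<close> for the
  original topology. So the identity from \<open>\<Delta>\<close> with its original, compact, topology to the new one is
  continuous.\<close>

lemma compactin_TD:
  assumes \<Delta>: "\<Delta> \<in> L"
  shows "compactin TD \<Delta>"
proof -
  interpret S: topological_comm_group "G\<lparr>carrier := \<Delta>\<rparr>" "subtopology T \<Delta>"
    by (rule subgroup_topological_comm_group[OF L_subgroup[OF \<Delta>]])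
  have top: "topspace (subtopology T \<Delta>) = \<Delta>" using S.topspace_eq by simp
  have "continuous_map (subtopology T \<Delta>) TD (\<lambda>x. x)"
  proof (rule D.continuous_map_if_close)
    show "(\<lambda>x. x) \<in> topspace (subtopology T \<Delta>) \<rightarrow> carrier D" using \<Delta> by (auto simp: carrier_D)
    fix x \<Delta>' assume x: "x \<in> topspace (subtopology T \<Delta>)" and \<Delta>': "\<Delta>' \<in> L"
    let ?U = "{y \<in> topspace (subtopology T \<Delta>). inv x \<otimes> y \<in> \<Delta> \<inter> \<Delta>'}"
    have xD: "x \<in> \<Delta>" "inv x \<in> \<Delta>" "x \<in> carrier D" "x \<in> carrier G"
      using x subgroup.m_inv_closed[OF L_subgroup[OF \<Delta>]] \<Delta> L_subset_carrier
      by (auto simp: carrier_D)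
    have "openin (subtopology T \<Delta>) ?U"
      using openin_continuous_map_preimage[OF S.continuous_map_translation
          profinite_lattice_commensurable[OF L_lattice[OF \<Delta>] L_lattice[OF \<Delta>']], of "inv x"] xD by simp
    moreover have "x \<in> ?U"
      using x xD subgroup.one_closed[OF L_subgroup] \<Delta> \<Delta>' by simp
    moreover have "y \<in> x <#\<^bsub>D\<^esub> \<Delta>'" if "y \<in> ?U" for y
      using that \<Delta> by (auto simp: in_l_coset_D_iff[OF xD(3) \<Delta>'] carrier_D)
    ultimately show "\<exists>U. openin (subtopology T \<Delta>) U \<and> x \<in> U \<and> (\<forall>y\<in>U. y \<in> x <#\<^bsub>D\<^esub> \<Delta>')" by blast
  qed
  moreover have "compactin (subtopology T \<Delta>) \<Delta>"
    using L_compact_space[OF \<Delta>] top by (simp add: compact_space_def)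
  ultimately show ?thesis
    using image_compactin[of "subtopology T \<Delta>" \<Delta> TD "\<lambda>x. x"] by simp
qed

lemma closedin_TD: "\<Delta> \<in> L \<Longrightarrow> closedin TD \<Delta>"
  using compactin_imp_closedin[OF topological_comm_group.Hausdorff[OF topological_comm_group_D] compactin_TD] .

text \<open>Otherwise the closed sets \<open>\<Delta> - U\<close> would all be nonempty, and by compactness they would have a common
  point, which cannot be the identity.\<close>

lemma open_nhd_contains_member_of_L:
  assumes U: "openin T U" "\<one> \<in> U"
  obtains \<Delta> where "\<Delta> \<in> L" "\<Delta> \<subseteq> U"
proof (rule ccontr)
  assume "\<not> thesis"
  with that have none: "\<not> \<Delta> \<subseteq> U" if "\<Delta> \<in> L" for \<Delta> using \<open>\<Delta> \<in> L\<close> by blast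
  obtain \<Delta>0 where \<Delta>0: "\<Delta>0 \<in> L" using L_nonempty by blast
  have "\<Delta>0 \<inter> \<Inter>((\<lambda>\<Delta>. \<Delta> - U) ` L) \<noteq> {}"
  proof (rule compactin_directed_Inter_nonempty[of T])
    show "compactin T \<Delta>0" using profinite_latticeD(2)[OF L_lattice[OF \<Delta>0]] .
    show "(\<lambda>\<Delta>. \<Delta> - U) ` L \<noteq> {}" using L_nonempty by blast
    fix C assume "C \<in> (\<lambda>\<Delta>. \<Delta> - U) ` L"
    then obtain \<Delta> where \<Delta>: "\<Delta> \<in> L" "C = \<Delta> - U" by blast
    then show "closedin T C" using L_closedin U by (simp add: closedin_diff)
    show "\<Delta>0 \<inter> C \<noteq> {}" using none[OF L_meet[OF \<Delta>0 \<Delta>(1)]] \<Delta>(2) by blast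
    fix C' assume "C' \<in> (\<lambda>\<Delta>. \<Delta> - U) ` L"
    then obtain \<Delta>' where \<Delta>': "\<Delta>' \<in> L" "C' = \<Delta>' - U" by blast
    then show "\<exists>C''\<in>(\<lambda>\<Delta>. \<Delta> - U) ` L. C'' \<subseteq> C \<inter> C'"
      using L_meet[OF \<Delta>(1) \<Delta>'(1)] \<Delta> by (intro bexI[of _ "\<Delta> \<inter> \<Delta>' - U"]) auto
  qed
  then show False using Inter_trivial U L_nonempty by auto
qed

lemma identity_continuous_TD_T: "continuous_map TD T (\<lambda>x. x)"
  unfolding continuous_map
proof (intro conjI allI impI)
  show "(\<lambda>x. x) ` topspace TD \<subseteq> topspace T"
    using L_subset_carrier by (auto simp: topspace_TD topspace_eq)
  fix U assume U: "openin T U"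
  show "openin TD {x \<in> topspace TD. x \<in> U}"
    unfolding D.openin_iff
  proof (intro conjI ballI)
    show "{x \<in> topspace TD. x \<in> U} \<subseteq> carrier D" by (auto simp: topspace_TD carrier_D)
    fix x assume x: "x \<in> {x \<in> topspace TD. x \<in> U}"
    then have xD: "x \<in> carrier D" "x \<in> carrier G" "x \<in> U"
      using carrier_D_subset by (auto simp: topspace_TD carrier_D)
    have "openin T {y \<in> topspace T. x \<otimes> y \<in> U}"
      by (rule openin_continuous_map_preimage[OF continuous_map_translation[OF xD(2)] U])
    moreover have "\<one> \<in> {y \<in> topspace T. x \<otimes> y \<in> U}" using xD by (simp add: topspace_eq)
    ultimately obtain \<Delta> where \<Delta>: "\<Delta> \<in> L" "\<Delta> \<subseteq> {y \<in> topspace T. x \<otimes> y \<in> U}"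
      using open_nhd_contains_member_of_L by blast
    have "x <#\<^bsub>D\<^esub> \<Delta> \<subseteq> {x \<in> topspace TD. x \<in> U}"
    proof
      fix y assume "y \<in> x <#\<^bsub>D\<^esub> \<Delta>"
      then have "y \<in> carrier D" and "\<exists>d\<in>\<Delta>. y = x \<otimes> d"
        using in_l_coset_D_iff[OF xD(1) \<Delta>(1)] by (auto simp: l_coset_def)
      then show "y \<in> {x \<in> topspace TD. x \<in> U}" using \<Delta>(2) by (auto simp: topspace_TD carrier_D)
    qed
    then show "\<exists>\<Delta>\<in>L. x <#\<^bsub>D\<^esub> \<Delta> \<subseteq> {x \<in> topspace TD. x \<in> U}" using \<Delta> by blast
  qed
qed

lemma locally_compact_D: "locally_compact_group D TD"
  unfolding locally_compact_group_def locally_compact_space_def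
proof (intro conjI topological_comm_group_D ballI)
  fix x assume "x \<in> topspace TD"
  then obtain \<Delta> where "\<Delta> \<in> L" "x \<in> \<Delta>" by (auto simp: topspace_TD)
  then show "\<exists>U K. openin TD U \<and> compactin TD K \<and> x \<in> U \<and> U \<subseteq> K"
    using openin_TD compactin_TD by blast
qed

lemma totally_disconnected_TD: "totally_disconnected_space TD"
  unfolding totally_disconnected_space_def
proof (intro allI impI)
  fix S assume S: "connectedin TD S"
  have SD: "S \<subseteq> carrier D" using S D.topspace_eq_carrier by (simp add: connectedin_def)
  interpret DT: topological_comm_group D TD by (rule topological_comm_group_D)
  have "x = y" if x: "x \<in> S" and y: "y \<in> S" for x y
  proof -
    have xy: "x \<in> carrier D" "y \<in> carrier D" "x \<in> carrier G" "y \<in> carrier G"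
      using x y SD carrier_D_subset by auto
    \<comment> \<open>translated to the identity, a connected set cannot leave the clopen set \<open>\<Delta>\<close>\<close>
    have "inv x \<otimes> y \<in> \<Delta>" if \<Delta>: "\<Delta> \<in> L" for \<Delta>
    proof -
      let ?f = "\<lambda>z. inv\<^bsub>D\<^esub> x \<otimes>\<^bsub>D\<^esub> z"
      have "connectedin TD (?f ` S)"
        by (rule connectedin_continuous_map_image[OF DT.continuous_map_translation S]) (use xy in simp)
      moreover have "\<one> \<in> ?f ` S \<inter> \<Delta>"
        using x xy subgroup.one_closed[OF L_subgroup[OF \<Delta>]]
        by (auto intro!: image_eqI[of _ _ x] simp: inv_D)
      ultimately have "?f ` S \<subseteq> \<Delta>"
        using connectedin_clopen_cases[OF _ closedin_TD[OF \<Delta>] openin_TD[OF \<Delta>]] by (auto simp: disjnt_iff)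
      then show ?thesis using y xy by (auto simp: inv_D)
    qed
    then have "inv x \<otimes> y = \<one>" using Inter_trivial by blast
    then show ?thesis using xy by (metis inv_solve_left inv_closed one_closed r_one)
  qed
  then show "\<exists>x. S \<subseteq> {x}" by blast
qed

lemma periodic_D: "periodic_group D TD"
  unfolding periodic_group_def
proof (intro conjI locally_compact_D totally_disconnected_TD ballI)
  fix g assume "g \<in> carrier D"
  then obtain \<Delta> where \<Delta>: "\<Delta> \<in> L" "g \<in> \<Delta>" by (auto simp: carrier_D)
  have "subgroup \<Delta> D"
    unfolding D_eq using subgroup_incl[OF L_subgroup[OF \<Delta>(1)] subgroup_D] \<Delta> by blast
  then have "generate D {g} \<subseteq> \<Delta>" using D.generate_subgroup_incl \<Delta> by blast
  then have "TD closure_of generate D {g} \<subseteq> \<Delta>"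
    using closedin_TD[OF \<Delta>(1)] by (simp add: closure_of_minimal)
  then show "compactin TD (TD closure_of generate D {g})"
    using compactin_TD[OF \<Delta>(1)] by (meson closed_compactin closedin_closure_of)
qed

end

section \<open>Congruences modulo a subgroup\<close>

context comm_group
begin

lemma rcong_mult:
  assumes "subgroup H G" "(a, b) \<in> rcong H" "(c, d) \<in> rcong H"
  shows "(a \<otimes> c, b \<otimes> d) \<in> rcong H"
proof -
  have c: "a \<in> carrier G" "b \<in> carrier G" "c \<in> carrier G" "d \<in> carrier G"
    and h: "inv a \<otimes> b \<in> H" "inv c \<otimes> d \<in> H" using assms by (auto simp: r_congruent_def)
  have "inv (a \<otimes> c) \<otimes> (b \<otimes> d) = (inv a \<otimes> b) \<otimes> (inv c \<otimes> d)"
    using c by (simp add: inv_mult m_ac)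
  then show ?thesis using c subgroup.m_closed[OF assms(1) h] by (simp add: r_congruent_def)
qed

lemma rcong_int_pow:
  assumes "subgroup H G" "(a, b) \<in> rcong H"
  shows "(a [^] (k::int), b [^] k) \<in> rcong H"
proof -
  have c: "a \<in> carrier G" "b \<in> carrier G" and h: "inv a \<otimes> b \<in> H"
    using assms by (auto simp: r_congruent_def)
  have "inv (a [^] k) \<otimes> b [^] k = (inv a \<otimes> b) [^] k"
    using c by (simp add: int_pow_distrib int_pow_inv)
  then show ?thesis using c subgroup_int_pow_closed[OF assms(1) h] by (simp add: r_congruent_def)
qed

lemma rcong_sym: "subgroup H G \<Longrightarrow> (a, b) \<in> rcong H \<Longrightarrow> (b, a) \<in> rcong H"
  using subgroup.equiv_rcong[of H G] is_group by (auto simp: equiv_def dest: symD)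

lemma rcong_trans:
  "subgroup H G \<Longrightarrow> (a, b) \<in> rcong H \<Longrightarrow> (b, c) \<in> rcong H \<Longrightarrow> (a, c) \<in> rcong H"
  using subgroup.equiv_rcong[of H G] is_group by (auto simp: equiv_def dest: transD)

lemma rcong_refl: "subgroup H G \<Longrightarrow> a \<in> carrier G \<Longrightarrow> (a, a) \<in> rcong H"
  by (simp add: r_congruent_def subgroup.one_closed)

lemma rcong_pow_exponent:
  assumes H: "subgroup H G" and g: "g \<in> carrier G" "g [^] int n \<in> H" and k: "k mod int n = l mod int n"
  shows "(g [^] k, g [^] l) \<in> rcong H"
proof -
  obtain q where q: "l - k = int n * q" using k by (metis dvd_def mod_eq_dvd_iff)
  have "inv (g [^] k) \<otimes> g [^] l = g [^] (- k + l)"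
    using g by (simp only: int_pow_mult int_pow_neg)
  also have "\<dots> = (g [^] int n) [^] q" using g q by (simp add: int_pow_pow)
  finally show ?thesis
    using g subgroup_int_pow_closed[OF H g(2)] by (simp add: r_congruent_def)
qed

end

section \<open>The module structure over the profinite integers\<close>

context profinite_lattice_group
begin

text \<open>Finitely many cosets of \<open>\<Delta>\<close> cover a compact subgroup containing \<open>g\<close>, so two different powers of \<open>g\<close>
  lie in the same coset.\<close>

lemma some_power_in_L:
  assumes g: "g \<in> carrier D" and \<Delta>: "\<Delta> \<in> L"
  obtains n :: nat where "n \<ge> 1" "g [^] int n \<in> \<Delta>"
proof -
  obtain \<Delta>0 where \<Delta>0: "\<Delta>0 \<in> L" "g \<in> \<Delta>0" using g by (auto simp: carrier_D)
  have gG: "g \<in> carrier G" using g carrier_D_subset by blast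
  let ?\<U> = "{V. openin TD V \<and> (\<exists>x\<in>carrier G. V \<subseteq> x <# \<Delta>)}"
  have "\<exists>V\<in>?\<U>. x \<in> V" if x: "x \<in> carrier D" for x
  proof -
    obtain V where "openin TD V" "x \<in> V" "V \<subseteq> x <#\<^bsub>D\<^esub> \<Delta>"
      using D.open_nhd_within_coset[OF x \<Delta>] by blast
    moreover have "x <#\<^bsub>D\<^esub> \<Delta> = x <# \<Delta>" by (simp add: l_coset_def)
    ultimately show ?thesis using x carrier_D_subset by blast
  qed
  then have "\<Delta>0 \<subseteq> \<Union>?\<U>" using \<Delta>0 by (fastforce simp: carrier_D)
  then obtain \<F> where \<F>: "finite \<F>" "\<F> \<subseteq> ?\<U>" "\<Delta>0 \<subseteq> \<Union>\<F>"
    using compactinD[OF compactin_TD[OF \<Delta>0(1)], of ?\<U>] by blast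
  have "g [^] int k \<in> \<Delta>0" for k using subgroup_int_pow_closed[OF L_subgroup[OF \<Delta>0(1)] \<Delta>0(2)] .
  then have "\<forall>k. \<exists>V\<in>\<F>. g [^] int k \<in> V" using \<F>(3) by blast
  then obtain V where V: "\<And>k. V k \<in> \<F>" "\<And>k. g [^] int k \<in> V k" by metis
  have "\<not> inj (V :: nat \<Rightarrow> _)"
    using \<F>(1) V(1) finite_subset[of "range V" \<F>] finite_imageD[of V UNIV] by auto
  then obtain i' j' where "i' \<noteq> j'" "V i' = V j'" by (auto simp: inj_def)
  then obtain i j where ij: "i < j" "V i = V j" by (metis linorder_neqE_nat)
  obtain x where x: "x \<in> carrier G" "V i \<subseteq> x <# \<Delta>" using V(1) \<F>(2) by blast
  have "(x, g [^] int i) \<in> rcong \<Delta>" "(x, g [^] int j) \<in> rcong \<Delta>"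
    using V(2)[of i] V(2)[of j] x ij subgroup.l_coset_eq_rcong[OF L_subgroup[OF \<Delta>] is_group x(1)] by auto
  then have "(g [^] int i, g [^] int j) \<in> rcong \<Delta>"
    using rcong_trans rcong_sym L_subgroup[OF \<Delta>] by blast
  then have "inv (g [^] int i) \<otimes> g [^] int j \<in> \<Delta>" by (simp add: r_congruent_def)
  moreover have "inv (g [^] int i) \<otimes> g [^] int j = g [^] (- int i + int j)"
    using gG by (simp only: int_pow_mult int_pow_neg)
  moreover have "- int i + int j = int (j - i)" using ij by simp
  ultimately show thesis using that[of "j - i"] ij by simp
qed

text \<open>The relation says that \<open>h\<close> is the \<open>z\<close>-th power of \<open>g\<close>: modulo \<open>\<Delta>\<close> a power of \<open>g\<close> only depends on
  the exponent modulo any \<open>n\<close> with \<open>g ^ n \<in> \<Delta>\<close>, so the residue \<open>z n\<close> can serve as exponent.\<close>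

definition is_limit_power :: "(nat \<Rightarrow> int) \<Rightarrow> 'a \<Rightarrow> 'a \<Rightarrow> bool" where
  "is_limit_power z g h \<longleftrightarrow> h \<in> carrier D \<and>
     (\<forall>\<Delta>\<in>L. \<forall>n\<ge>1. g [^] int n \<in> \<Delta> \<longrightarrow> (g [^] z n, h) \<in> rcong \<Delta>)"

text \<open>For each \<open>\<Delta>\<close> a single \<open>n\<close> suffices, with any exponent in the residue class \<open>z n\<close>: a second choice \<open>m\<close>
  is compared with \<open>n\<close> through \<open>n * m\<close>, where \<open>z\<close> reduces to both residues. This is how all
  identities for powers are proved, with the exponent chosen to suit the identity.\<close>

lemma is_limit_powerI:
  assumes z: "z \<in> carrier Zhat" and g: "g \<in> carrier D" and h: "h \<in> carrier D"
    and close: "\<And>\<Delta>. \<Delta> \<in> L \<Longrightarrow>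
      \<exists>n k. n \<ge> 1 \<and> g [^] int n \<in> \<Delta> \<and> k mod int n = z n \<and> (g [^] k, h) \<in> rcong \<Delta>"
  shows "is_limit_power z g h"
  unfolding is_limit_power_def
proof (intro conjI h ballI allI impI)
  fix \<Delta> m assume \<Delta>: "\<Delta> \<in> L" and m: "1 \<le> m" "g [^] int m \<in> \<Delta>"
  obtain n k where n: "n \<ge> 1" "g [^] int n \<in> \<Delta>" "k mod int n = z n" "(g [^] k, h) \<in> rcong \<Delta>"
    using close[OF \<Delta>] by blast
  note sub = L_subgroup[OF \<Delta>]
  have gG: "g \<in> carrier G" using g carrier_D_subset by blast
  have nm: "n * m \<ge> 1" using n m by simp
  have "(g [^] z m, g [^] z (n * m)) \<in> rcong \<Delta>"
    using Zhat_compat[OF z nm m(1)] Zhat_mod_self[OF z m(1)]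
    by (intro rcong_pow_exponent[OF sub gG m(2)]) simp
  moreover have "(g [^] z (n * m), g [^] k) \<in> rcong \<Delta>"
    using Zhat_compat[OF z nm n(1)] n(3)
    by (intro rcong_pow_exponent[OF sub gG n(2)]) simp
  ultimately show "(g [^] z m, h) \<in> rcong \<Delta>" using n(4) rcong_trans[OF sub] by blast
qed

lemma is_limit_power_unique:
  assumes z: "z \<in> carrier Zhat" and g: "g \<in> carrier D"
    and h: "is_limit_power z g h" and h': "is_limit_power z g h'"
  shows "h = h'"
proof -
  have "inv h \<otimes> h' \<in> \<Delta>" if \<Delta>: "\<Delta> \<in> L" for \<Delta>
  proof -
    obtain n where "n \<ge> 1" "g [^] int n \<in> \<Delta>" using some_power_in_L[OF g \<Delta>] .
    then have "(g [^] z n, h) \<in> rcong \<Delta>" "(g [^] z n, h') \<in> rcong \<Delta>"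
      using h h' \<Delta> by (auto simp: is_limit_power_def)
    then have "(h, h') \<in> rcong \<Delta>" using rcong_trans rcong_sym L_subgroup[OF \<Delta>] by blast
    then show ?thesis by (simp add: r_congruent_def)
  qed
  then have "inv h \<otimes> h' = \<one>" using Inter_trivial by blast
  moreover have "h \<in> carrier G" "h' \<in> carrier G" using h h' carrier_D_subset by (auto simp: is_limit_power_def)
  ultimately show ?thesis by (metis inv_solve_left inv_closed one_closed r_one)
qed

text \<open>Inside a compact \<open>\<Delta>0\<close> containing \<open>g\<close>, the cosets prescribed by the definition are closed, meet \<open>\<Delta>0\<close>
  in a power of \<open>g\<close>, and are directed: the conditions for \<open>(\<Delta>, n)\<close> and \<open>(\<Delta>', n')\<close> both follow from the
  one for \<open>(\<Delta> \<inter> \<Delta>', n * n')\<close>.\<close>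

lemma is_limit_power_exists:
  assumes z: "z \<in> carrier Zhat" and g: "g \<in> carrier D"
  shows "\<exists>h. is_limit_power z g h"
proof -
  obtain \<Delta>0 where \<Delta>0: "\<Delta>0 \<in> L" "g \<in> \<Delta>0" using g by (auto simp: carrier_D)
  have gG: "g \<in> carrier G" using g carrier_D_subset by blast
  define I where "I = {(\<Delta>, n). \<Delta> \<in> L \<and> n \<ge> 1 \<and> g [^] int n \<in> \<Delta>}"
  define C where "C = (\<lambda>(\<Delta>, n). {h \<in> carrier G. (g [^] z n, h) \<in> rcong \<Delta>})"
  have "\<Delta>0 \<inter> \<Inter>(C ` I) \<noteq> {}"
  proof (rule compactin_directed_Inter_nonempty[of T])
    show "compactin T \<Delta>0" using profinite_latticeD(2)[OF L_lattice[OF \<Delta>0(1)]] .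
    have "(\<Delta>0, 1) \<in> I" using \<Delta>0 gG by (simp add: I_def)
    then show "C ` I \<noteq> {}" by blast
    fix A assume "A \<in> C ` I"
    then obtain \<Delta> n where \<Delta>: "\<Delta> \<in> L" "n \<ge> 1" "g [^] int n \<in> \<Delta>" "A = C (\<Delta>, n)" by (auto simp: I_def)
    have "A = {h \<in> topspace T. inv (g [^] z n) \<otimes> h \<in> \<Delta>}"
      using gG by (auto simp: \<Delta>(4) C_def r_congruent_def topspace_eq)
    then show "closedin T A"
      using closedin_continuous_map_preimage[OF continuous_map_translation L_closedin[OF \<Delta>(1)]] gG by simp
    have "g [^] z n \<in> \<Delta>0 \<inter> A"
      using subgroup_int_pow_closed[OF L_subgroup[OF \<Delta>0(1)] \<Delta>0(2)] rcong_refl[OF L_subgroup[OF \<Delta>(1)]] gG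
      by (simp add: \<Delta>(4) C_def)
    then show "\<Delta>0 \<inter> A \<noteq> {}" by blast
    fix A' assume "A' \<in> C ` I"
    then obtain \<Delta>' n' where \<Delta>': "\<Delta>' \<in> L" "n' \<ge> 1" "g [^] int n' \<in> \<Delta>'" "A' = C (\<Delta>', n')" by (auto simp: I_def)
    have nn: "n * n' \<ge> 1" using \<Delta> \<Delta>' by simp
    have "g [^] int (n * n') \<in> \<Delta>" "g [^] int (n * n') \<in> \<Delta>'"
      using subgroup_int_pow_closed[OF L_subgroup[OF \<Delta>(1)] \<Delta>(3), of "int n'"]
        subgroup_int_pow_closed[OF L_subgroup[OF \<Delta>'(1)] \<Delta>'(3), of "int n"] gG
      by (simp_all add: int_pow_pow mult.commute)
    then have "(\<Delta> \<inter> \<Delta>', n * n') \<in> I" using \<Delta> \<Delta>' nn L_meet by (simp add: I_def)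
    moreover have "C (\<Delta> \<inter> \<Delta>', n * n') \<subseteq> A \<inter> A'"
    proof
      fix h assume "h \<in> C (\<Delta> \<inter> \<Delta>', n * n')"
      then have h: "h \<in> carrier G" "(g [^] z (n * n'), h) \<in> rcong \<Delta>" "(g [^] z (n * n'), h) \<in> rcong \<Delta>'"
        by (auto simp: C_def r_congruent_def)
      have "(g [^] z n, g [^] z (n * n')) \<in> rcong \<Delta>"
        using Zhat_compat[OF z nn \<Delta>(2)] Zhat_mod_self[OF z \<Delta>(2)]
        by (intro rcong_pow_exponent[OF L_subgroup[OF \<Delta>(1)] gG \<Delta>(3)]) simp
      moreover have "(g [^] z n', g [^] z (n * n')) \<in> rcong \<Delta>'"
        using Zhat_compat[OF z nn \<Delta>'(2)] Zhat_mod_self[OF z \<Delta>'(2)]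
        by (intro rcong_pow_exponent[OF L_subgroup[OF \<Delta>'(1)] gG \<Delta>'(3)]) simp
      ultimately have "(g [^] z n, h) \<in> rcong \<Delta>" "(g [^] z n', h) \<in> rcong \<Delta>'"
        using h(2,3) by (blast intro: rcong_trans[OF L_subgroup[OF \<Delta>(1)]] rcong_trans[OF L_subgroup[OF \<Delta>'(1)]])+
      then show "h \<in> A \<inter> A'" using h(1) by (simp add: \<Delta>(4) \<Delta>'(4) C_def)
    qed
    ultimately show "\<exists>C''\<in>C ` I. C'' \<subseteq> A \<inter> A'" by blast
  qed
  then obtain h where h: "h \<in> \<Delta>0" "h \<in> \<Inter>(C ` I)" by blast
  have "is_limit_power z g h"
    unfolding is_limit_power_def
  proof (intro conjI ballI allI impI)
    show "h \<in> carrier D" using h \<Delta>0 by (auto simp: carrier_D)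
    fix \<Delta> n assume "\<Delta> \<in> L" "1 \<le> n" "g [^] int n \<in> \<Delta>"
    then have "(\<Delta>, n) \<in> I" by (simp add: I_def)
    then have "h \<in> C (\<Delta>, n)" using h by blast
    then show "(g [^] z n, h) \<in> rcong \<Delta>" by (simp add: C_def)
  qed
  then show ?thesis ..
qed

definition zpow :: "(nat \<Rightarrow> int) \<Rightarrow> 'a \<Rightarrow> 'a" where
  "zpow z g = (THE h. is_limit_power z g h)"

lemma is_limit_power_zpow:
  assumes "z \<in> carrier Zhat" "g \<in> carrier D"
  shows "is_limit_power z g (zpow z g)"
proof -
  obtain h where h: "is_limit_power z g h" using is_limit_power_exists[OF assms] by blast
  then show ?thesis
    unfolding zpow_def by (rule theI[of "is_limit_power z g"]) (rule is_limit_power_unique[OF assms _ h])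
qed

lemma zpow_eqI:
  assumes "z \<in> carrier Zhat" "g \<in> carrier D" "is_limit_power z g h"
  shows "zpow z g = h"
  using is_limit_power_unique[OF assms(1,2) is_limit_power_zpow[OF assms(1,2)] assms(3)] .

lemma zpow_closed: "z \<in> carrier Zhat \<Longrightarrow> g \<in> carrier D \<Longrightarrow> zpow z g \<in> carrier D"
  using is_limit_power_zpow by (simp add: is_limit_power_def)

lemma zpow_cong:
  assumes "z \<in> carrier Zhat" "g \<in> carrier D" "\<Delta> \<in> L" "n \<ge> 1" "g [^] int n \<in> \<Delta>"
  shows "(g [^] z n, zpow z g) \<in> rcong \<Delta>"
  using is_limit_power_zpow[OF assms(1,2)] assms(3-5) unfolding is_limit_power_def by blast

lemma mult_closed_D: "g \<in> carrier D \<Longrightarrow> h \<in> carrier D \<Longrightarrow> g \<otimes> h \<in> carrier D"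
  using D.m_closed by simp

lemma zpow_int:
  assumes g: "g \<in> carrier D"
  shows "zpow (int_to_Zhat k) g = g [^] k"
proof (rule zpow_eqI[OF int_to_Zhat_closed g is_limit_powerI[OF int_to_Zhat_closed g]])
  show "g [^] k \<in> carrier D"
    using g subgroup_int_pow_closed[OF subgroup_D] by (simp add: carrier_D)
  fix \<Delta> assume \<Delta>: "\<Delta> \<in> L"
  obtain n where n: "n \<ge> 1" "g [^] int n \<in> \<Delta>" using some_power_in_L[OF g \<Delta>] .
  have "(g [^] k, g [^] k) \<in> rcong \<Delta>" using rcong_refl[OF L_subgroup[OF \<Delta>]] g carrier_D_subset by auto
  then show "\<exists>n l. n \<ge> 1 \<and> g [^] int n \<in> \<Delta> \<and> l mod int n = int_to_Zhat k n \<and> (g [^] l, g [^] k) \<in> rcong \<Delta>"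
    using n by (intro exI[of _ n] exI[of _ k]) (auto simp: int_to_Zhat_def)
qed

lemma zpow_add:
  assumes z: "z \<in> carrier Zhat" and w: "w \<in> carrier Zhat" and g: "g \<in> carrier D"
  shows "zpow (z \<oplus>\<^bsub>Zhat\<^esub> w) g = zpow z g \<otimes> zpow w g"
proof (rule zpow_eqI[OF Zhat_add_closed[OF z w] g is_limit_powerI[OF Zhat_add_closed[OF z w] g]])
  show "zpow z g \<otimes> zpow w g \<in> carrier D" using zpow_closed mult_closed_D z w g by simp
  fix \<Delta> assume \<Delta>: "\<Delta> \<in> L"
  obtain n where n: "n \<ge> 1" "g [^] int n \<in> \<Delta>" using some_power_in_L[OF g \<Delta>] .
  have "(g [^] z n \<otimes> g [^] w n, zpow z g \<otimes> zpow w g) \<in> rcong \<Delta>"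
    using n z w g \<Delta> by (intro rcong_mult L_subgroup zpow_cong)
  then have "(g [^] (z n + w n), zpow z g \<otimes> zpow w g) \<in> rcong \<Delta>"
    using g carrier_D_subset by (subst int_pow_mult) auto
  then show "\<exists>n l. n \<ge> 1 \<and> g [^] int n \<in> \<Delta> \<and> l mod int n = (z \<oplus>\<^bsub>Zhat\<^esub> w) n \<and>
      (g [^] l, zpow z g \<otimes> zpow w g) \<in> rcong \<Delta>"
    using n by (intro exI[of _ n] exI[of _ "z n + w n"]) (auto simp: Zhat_simps)
qed

lemma zpow_distrib:
  assumes z: "z \<in> carrier Zhat" and g: "g \<in> carrier D" and h: "h \<in> carrier D"
  shows "zpow z (g \<otimes> h) = zpow z g \<otimes> zpow z h"
proof (rule zpow_eqI[OF z mult_closed_D[OF g h] is_limit_powerI[OF z mult_closed_D[OF g h]]])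
  show "zpow z g \<otimes> zpow z h \<in> carrier D" using zpow_closed mult_closed_D z g h by simp
  fix \<Delta> assume \<Delta>: "\<Delta> \<in> L"
  note sub = L_subgroup[OF \<Delta>]
  have gh: "g \<in> carrier G" "h \<in> carrier G" using g h carrier_D_subset by auto
  obtain m n where mn: "m \<ge> 1" "g [^] int m \<in> \<Delta>" "n \<ge> 1" "h [^] int n \<in> \<Delta>"
    using some_power_in_L[OF g \<Delta>] some_power_in_L[OF h \<Delta>] by metis
  have N: "m * n \<ge> 1" "g [^] int (m * n) \<in> \<Delta>" "h [^] int (m * n) \<in> \<Delta>"
    using mn subgroup_int_pow_closed[OF sub mn(2), of "int n"]
      subgroup_int_pow_closed[OF sub mn(4), of "int m"] gh
    by (simp_all add: int_pow_pow mult.commute)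
  have "(g [^] z (m * n) \<otimes> h [^] z (m * n), zpow z g \<otimes> zpow z h) \<in> rcong \<Delta>"
    using N z g h \<Delta> by (intro rcong_mult L_subgroup zpow_cong)
  then have "((g \<otimes> h) [^] z (m * n), zpow z g \<otimes> zpow z h) \<in> rcong \<Delta>"
    using gh by (simp add: int_pow_distrib)
  moreover have "(g \<otimes> h) [^] int (m * n) \<in> \<Delta>"
    using N subgroup.m_closed[OF sub] gh by (simp only: int_pow_distrib)
  ultimately show "\<exists>n l. n \<ge> 1 \<and> (g \<otimes> h) [^] int n \<in> \<Delta> \<and> l mod int n = z n \<and>
      ((g \<otimes> h) [^] l, zpow z g \<otimes> zpow z h) \<in> rcong \<Delta>"
    using N Zhat_mod_self[OF z N(1)] by (intro exI[of _ "m * n"] exI[of _ "z (m * n)"] conjI)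
qed

text \<open>If \<open>g ^ n \<in> \<Delta>\<close>, then the power \<open>h\<close> of \<open>g\<close> with exponent \<open>w\<close> is congruent to \<open>g ^ w n\<close>, so that
  \<open>h ^ n\<close> is in \<open>\<Delta>\<close> as well and the same \<open>n\<close> can be used for both powers.\<close>

lemma zpow_mult:
  assumes z: "z \<in> carrier Zhat" and w: "w \<in> carrier Zhat" and g: "g \<in> carrier D"
  shows "zpow (z \<otimes>\<^bsub>Zhat\<^esub> w) g = zpow z (zpow w g)"
proof (rule zpow_eqI[OF Zhat_mult_closed[OF z w] g is_limit_powerI[OF Zhat_mult_closed[OF z w] g]])
  let ?h = "zpow w g"
  have h: "?h \<in> carrier D" using zpow_closed w g by simp
  show "zpow z ?h \<in> carrier D" using zpow_closed z h by simp
  fix \<Delta> assume \<Delta>: "\<Delta> \<in> L"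
  note sub = L_subgroup[OF \<Delta>]
  have gh: "g \<in> carrier G" "?h \<in> carrier G" using g h carrier_D_subset by auto
  obtain n where n: "n \<ge> 1" "g [^] int n \<in> \<Delta>" using some_power_in_L[OF g \<Delta>] .
  have gw: "(g [^] w n, ?h) \<in> rcong \<Delta>"
    using n w g \<Delta> by (intro zpow_cong)
  have "?h [^] int n \<in> \<Delta>"
  proof -
    have "(g [^] w n) [^] int n = (g [^] int n) [^] w n" using gh by (simp add: int_pow_pow mult.commute)
    then have a: "(g [^] w n) [^] int n \<in> \<Delta>" using subgroup_int_pow_closed[OF sub n(2)] by simp
    have "inv ((g [^] w n) [^] int n) \<otimes> ?h [^] int n \<in> \<Delta>"
      using rcong_int_pow[OF sub gw, of "int n"] by (simp add: r_congruent_def)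
    from subgroup.m_closed[OF sub a this] show ?thesis
      using gh by (simp add: m_assoc[symmetric])
  qed
  then have "(?h [^] z n, zpow z ?h) \<in> rcong \<Delta>"
    using n z h \<Delta> by (intro zpow_cong)
  with rcong_int_pow[OF sub gw, of "z n"]
  have "((g [^] w n) [^] z n, zpow z ?h) \<in> rcong \<Delta>" by (rule rcong_trans[OF sub])
  then have "(g [^] (w n * z n), zpow z ?h) \<in> rcong \<Delta>" using gh by (simp add: int_pow_pow)
  then show "\<exists>n l. n \<ge> 1 \<and> g [^] int n \<in> \<Delta> \<and> l mod int n = (z \<otimes>\<^bsub>Zhat\<^esub> w) n \<and>
      (g [^] l, zpow z ?h) \<in> rcong \<Delta>"
    using n by (intro exI[of _ n] exI[of _ "w n * z n"]) (auto simp: Zhat_simps mult.commute)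
qed

lemma module_zpow: "Module.module Zhat (module_of D zpow)"
proof (rule moduleI)
  show "cring Zhat" by (rule cring_Zhat)
  show "abelian_group (module_of D zpow)"
  proof (rule abelian_groupI)
    fix x assume "x \<in> carrier (module_of D zpow)"
    then show "\<exists>y\<in>carrier (module_of D zpow). y \<oplus>\<^bsub>module_of D zpow\<^esub> x = \<zero>\<^bsub>module_of D zpow\<^esub>"
      using D.l_inv[of x] D.inv_closed[of x] by (auto simp: module_of_def)
  qed (use D.m_closed D.m_assoc D.m_comm D.l_one D.one_closed in \<open>auto simp: module_of_def\<close>)
qed (use zpow_closed zpow_add zpow_distrib zpow_mult zpow_int[of _ 1] carrier_D_subset in
    \<open>auto simp: module_of_def Zhat_simps(3) int_to_Zhat_def subset_iff\<close>)

text \<open>Modulo \<open>\<Delta>\<close>, the power of \<open>g\<close> with exponent \<open>z\<close> depends only on the coset of \<open>g\<close> and, once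
  \<open>g ^ n \<in> \<Delta>\<close>, on the coordinate \<open>z n\<close>; fixing both is an open condition.\<close>

lemma continuous_zpow: "continuous_map (prod_topology Zhat_topology TD) TD (\<lambda>(z, g). zpow z g)"
proof (rule D.continuous_map_if_close)
  show "(\<lambda>(z, g). zpow z g) \<in> topspace (prod_topology Zhat_topology TD) \<rightarrow> carrier D"
    using zpow_closed by (auto simp: topspace_Zhat_topology D.topspace_eq_carrier)
  fix p \<Delta> assume p: "p \<in> topspace (prod_topology Zhat_topology TD)" and \<Delta>: "\<Delta> \<in> L"
  obtain z g where zg: "p = (z, g)" "z \<in> carrier Zhat" "g \<in> carrier D"
    using p by (auto simp: topspace_Zhat_topology D.topspace_eq_carrier)
  note sub = L_subgroup[OF \<Delta>]
  obtain n where n: "n \<ge> 1" "g [^] int n \<in> \<Delta>" using some_power_in_L[OF zg(3) \<Delta>] .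
  obtain V where V: "openin TD V" "g \<in> V" "V \<subseteq> g <#\<^bsub>D\<^esub> \<Delta>"
    using D.open_nhd_within_coset[OF zg(3) \<Delta>] .
  let ?U = "{w \<in> topspace Zhat_topology. w n \<in> {z n}}"
  have "openin Zhat_topology ?U"
    using Zhat_range[OF zg(2) n(1)]
    by (intro openin_continuous_map_preimage[OF continuous_map_Zhat_coordinate[OF n(1)]]) simp
  then have "openin (prod_topology Zhat_topology TD) (?U \<times> V)"
    using V by (simp add: openin_prod_Times_iff)
  moreover have "p \<in> ?U \<times> V" using zg V by (simp add: topspace_Zhat_topology)
  moreover have "zpow w h \<in> zpow z g <#\<^bsub>D\<^esub> \<Delta>" if w: "w \<in> ?U" and h: "h \<in> V" for w h
  proof -
    have w': "w \<in> carrier Zhat" "w n = z n" using w by (auto simp: topspace_Zhat_topology)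
    have hD: "h \<in> carrier D" "inv g \<otimes> h \<in> \<Delta>"
      using h V in_l_coset_D_iff[OF zg(3) \<Delta>] by auto
    have gh: "(g, h) \<in> rcong \<Delta>" using hD zg(3) carrier_D_subset by (auto simp: r_congruent_def)
    have hn: "h [^] int n \<in> \<Delta>"
    proof -
      have "inv (g [^] int n) \<otimes> h [^] int n \<in> \<Delta>"
        using rcong_int_pow[OF sub gh, of "int n"] by (simp add: r_congruent_def)
      from subgroup.m_closed[OF sub n(2) this] show ?thesis
        using gh by (simp add: m_assoc[symmetric] r_congruent_def)
    qed
    have "(g [^] z n, zpow z g) \<in> rcong \<Delta>" "(h [^] z n, zpow w h) \<in> rcong \<Delta>"
      using zpow_cong[OF zg(2,3) \<Delta> n] zpow_cong[OF w'(1) hD(1) \<Delta> n(1) hn] w'(2) by simp_all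
    with rcong_int_pow[OF sub gh, of "z n"] have "(zpow z g, zpow w h) \<in> rcong \<Delta>"
      using rcong_trans[OF sub] rcong_sym[OF sub] by blast
    then show ?thesis
      using zpow_closed w' hD zg by (simp add: in_l_coset_D_iff \<Delta> r_congruent_def)
  qed
  ultimately show "\<exists>U. openin (prod_topology Zhat_topology TD) U \<and> p \<in> U \<and>
      (\<forall>q\<in>U. (case q of (z, g) \<Rightarrow> zpow z g) \<in> (case p of (z, g) \<Rightarrow> zpow z g) <#\<^bsub>D\<^esub> \<Delta>)"
    using zg by (intro exI[of _ "?U \<times> V"]) auto
qed

text \<open>The power with exponent \<open>z\<close> is a limit of ordinary powers by definition. Conversely the orbit is
  closed, as a continuous image of the compact ring of profinite integers, and contains all ordinary
  powers.\<close>

lemma zpow_image_eq_closure: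
  assumes g: "g \<in> carrier D"
  shows "(\<lambda>z. zpow z g) ` carrier Zhat = TD closure_of generate D {g}"
proof
  have gen: "generate D {g} = range (\<lambda>k::int. g [^] k)"
  proof -
    have "generate D {g} = generate G {g}"
      unfolding D_eq using generate_consistent[OF _ subgroup_D, of "{g}"] g by (simp add: carrier_D)
    also have "\<dots> = range (\<lambda>k::int. g [^] k)"
      using g carrier_D_subset by (subst generate_pow) auto
    finally show ?thesis .
  qed
  show "(\<lambda>z. zpow z g) ` carrier Zhat \<subseteq> TD closure_of generate D {g}"
  proof clarify
    fix z assume z: "z \<in> carrier Zhat"
    show "zpow z g \<in> TD closure_of generate D {g}"
      unfolding in_closure_of
    proof (intro conjI allI impI)
      show "zpow z g \<in> topspace TD" using zpow_closed[OF z g] by (simp add: D.topspace_eq_carrier)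
      fix U assume U: "zpow z g \<in> U \<and> openin TD U"
      then obtain \<Delta> where \<Delta>: "\<Delta> \<in> L" "zpow z g <#\<^bsub>D\<^esub> \<Delta> \<subseteq> U" using D.openin_iff by blast
      obtain n where n: "n \<ge> 1" "g [^] int n \<in> \<Delta>" using some_power_in_L[OF g \<Delta>(1)] .
      have "(g [^] z n, zpow z g) \<in> rcong \<Delta>"
        using zpow_cong[OF z g \<Delta>(1) n] .
      then have "(zpow z g, g [^] z n) \<in> rcong \<Delta>" using rcong_sym[OF L_subgroup[OF \<Delta>(1)]] by blast
      then have "g [^] z n \<in> zpow z g <#\<^bsub>D\<^esub> \<Delta>"
        using in_l_coset_D_iff[OF zpow_closed[OF z g] \<Delta>(1)] g subgroup_int_pow_closed[OF subgroup_D]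
        by (simp add: r_congruent_def carrier_D)
      then show "\<exists>y. y \<in> generate D {g} \<and> y \<in> U" using \<Delta> gen by blast
    qed
  qed
  have "continuous_map Zhat_topology TD (\<lambda>z. zpow z g)"
    using continuous_map_compose[OF _ continuous_zpow, of Zhat_topology "\<lambda>z. (z, g)"] g
    by (simp add: o_def continuous_map_pairwise D.topspace_eq_carrier)
  then have "compactin TD ((\<lambda>z. zpow z g) ` carrier Zhat)"
    using image_compactin[of Zhat_topology "carrier Zhat"] compact_space_Zhat_topology
    by (simp add: compact_space_def topspace_Zhat_topology)
  then have "closedin TD ((\<lambda>z. zpow z g) ` carrier Zhat)"
    using topological_comm_group.Hausdorff[OF topological_comm_group_D] by (rule compactin_imp_closedin[rotated])
  moreover have "generate D {g} \<subseteq> (\<lambda>z. zpow z g) ` carrier Zhat"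
    unfolding gen using zpow_int[OF g] int_to_Zhat_closed by (auto intro!: image_eqI)
  ultimately show "TD closure_of generate D {g} \<subseteq> (\<lambda>z. zpow z g) ` carrier Zhat"
    by (simp add: closure_of_minimal)
qed

end

section \<open>The group of one-parameter subgroups\<close>

context topological_comm_group
begin

abbreviation "LG \<equiv> lie_group G T"
abbreviation "TL \<equiv> lie_topology G T"

lemma lie_group_simps [simp]:
  "(f \<otimes>\<^bsub>LG\<^esub> g) t = f t \<otimes> g t" "\<one>\<^bsub>LG\<^esub> t = \<one>"
  by (simp_all add: lie_group_def)

lemma lie_memI:
  assumes "\<And>t. f t \<in> carrier G" "\<And>s t. f (s + t) = f s \<otimes> f t" "continuous_map euclideanreal T f"
  shows "f \<in> carrier LG"
  using assms by (auto simp: lie_group_def hom_def)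

lemma
  assumes "f \<in> carrier LG"
  shows lie_closed: "f t \<in> carrier G"
    and lie_add: "f (s + t) = f s \<otimes> f t"
    and lie_continuous: "continuous_map euclideanreal T f"
  using assms by (auto simp: lie_group_def hom_def)

lemma lie_zero: "f \<in> carrier LG \<Longrightarrow> f 0 = \<one>"
  using lie_add[of f 0 0] lie_closed[of f 0] by (simp add: l_cancel_one')

lemma lie_uminus: "f \<in> carrier LG \<Longrightarrow> f (- t) = inv (f t)"
  using lie_add[of f "- t" t] lie_closed[of f] lie_zero[of f] by (metis add.left_inverse inv_equality)

lemma comm_group_lie_group: "comm_group LG"
proof (rule comm_groupI)
  fix f g assume f: "f \<in> carrier LG" and g: "g \<in> carrier LG"
  show "f \<otimes>\<^bsub>LG\<^esub> g \<in> carrier LG"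
  proof (rule lie_memI)
    have "continuous_map euclideanreal T (\<lambda>t. f t \<otimes> g t)"
      using f g by (intro continuous_map_mult lie_continuous)
    then show "continuous_map euclideanreal T (f \<otimes>\<^bsub>LG\<^esub> g)" by (simp add: lie_group_def)
  qed (use f g in \<open>auto simp: lie_closed lie_add m_ac\<close>)
  show "f \<otimes>\<^bsub>LG\<^esub> g = g \<otimes>\<^bsub>LG\<^esub> f"
    using f g by (auto simp: fun_eq_iff lie_closed m_comm)
next
  fix f g h assume "f \<in> carrier LG" "g \<in> carrier LG" "h \<in> carrier LG"
  then show "f \<otimes>\<^bsub>LG\<^esub> g \<otimes>\<^bsub>LG\<^esub> h = f \<otimes>\<^bsub>LG\<^esub> (g \<otimes>\<^bsub>LG\<^esub> h)"
    by (auto simp: fun_eq_iff lie_closed m_assoc)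
next
  show "\<one>\<^bsub>LG\<^esub> \<in> carrier LG"
    by (rule lie_memI) (auto simp: lie_group_def topspace_eq)
next
  fix f assume f: "f \<in> carrier LG"
  show "\<one>\<^bsub>LG\<^esub> \<otimes>\<^bsub>LG\<^esub> f = f" using f by (auto simp: fun_eq_iff lie_closed)
  have "(\<lambda>t. inv (f t)) \<in> carrier LG"
    using continuous_map_compose[OF lie_continuous[OF f] continuous_inv] f
    by (intro lie_memI) (auto simp: lie_closed lie_add inv_mult o_def)
  moreover have "(\<lambda>t. inv (f t)) \<otimes>\<^bsub>LG\<^esub> f = \<one>\<^bsub>LG\<^esub>" using f by (auto simp: fun_eq_iff lie_closed)
  ultimately show "\<exists>g\<in>carrier LG. g \<otimes>\<^bsub>LG\<^esub> f = \<one>\<^bsub>LG\<^esub>" by blast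
qed

sublocale LG: comm_group LG
  by (rule comm_group_lie_group)

lemma lie_inv:
  assumes f: "f \<in> carrier LG"
  shows "(inv\<^bsub>LG\<^esub> f) t = inv (f t)"
proof -
  have "inv\<^bsub>LG\<^esub> f \<otimes>\<^bsub>LG\<^esub> f = \<one>\<^bsub>LG\<^esub>" using f by (rule LG.l_inv)
  then have "(inv\<^bsub>LG\<^esub> f) t \<otimes> f t = \<one>" by (metis lie_group_simps)
  then show ?thesis
    using lie_closed[OF f] lie_closed[OF LG.inv_closed[OF f]] by (metis inv_equality)
qed

text \<open>The basic neighbourhoods of the identity for the topology of compact convergence.\<close>

definition lie_nhd :: "real set \<Rightarrow> 'a set \<Rightarrow> (real \<Rightarrow> 'a) set" where
  "lie_nhd C U = {g \<in> carrier LG. \<forall>t\<in>C. g t \<in> U}"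

lemma l_coset_lie_nhd:
  assumes f: "f \<in> carrier LG"
  shows "f <#\<^bsub>LG\<^esub> lie_nhd C U = {g \<in> carrier LG. \<forall>t\<in>C. g t \<otimes> inv (f t) \<in> U}"
proof -
  have "g \<in> f <#\<^bsub>LG\<^esub> lie_nhd C U \<longleftrightarrow> g \<in> carrier LG \<and> inv\<^bsub>LG\<^esub> f \<otimes>\<^bsub>LG\<^esub> g \<in> lie_nhd C U" for g
    using f by (intro LG.in_l_coset_iff) (auto simp: lie_nhd_def)
  moreover have "inv (f t) \<otimes> g t = g t \<otimes> inv (f t)" if "g \<in> carrier LG" for g t
    using f that by (simp add: lie_closed m_comm)
  ultimately show ?thesis
    using f by (auto simp: lie_nhd_def lie_inv)
qed

abbreviation "lie_basis \<equiv> {lie_nhd C U | C U. compact C \<and> openin T U \<and> \<one> \<in> U}"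

lemma basis_at_identity_lie: "basis_at_identity LG TL lie_basis"
proof
  show "openin TL W \<longleftrightarrow> W \<subseteq> carrier LG \<and> (\<forall>f\<in>W. \<exists>N\<in>lie_basis. f <#\<^bsub>LG\<^esub> N \<subseteq> W)" for W
  proof -
    have "(\<exists>N\<in>lie_basis. f <#\<^bsub>LG\<^esub> N \<subseteq> W) \<longleftrightarrow> (\<exists>C U. compact C \<and> openin T U \<and> \<one> \<in> U \<and>
        {g \<in> carrier LG. \<forall>t\<in>C. g t \<otimes> inv (f t) \<in> U} \<subseteq> W)" if "f \<in> carrier LG" for f
      unfolding l_coset_lie_nhd[OF that, symmetric] by blast
    then show ?thesis unfolding openin_lie_topology by (auto simp: subset_iff)
  qed
  have "openin T (carrier G)" using openin_topspace[of T] by (simp add: topspace_eq)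
  then show "lie_basis \<noteq> {}" using compact_empty by blast
  fix N assume "N \<in> lie_basis"
  then obtain C U where N: "N = lie_nhd C U" "compact C" "openin T U" "\<one> \<in> U" by blast
  show "N \<subseteq> carrier LG" "\<one>\<^bsub>LG\<^esub> \<in> N" using N by (auto simp: lie_nhd_def)
  obtain V where V: "openin T V" "\<one> \<in> V" "V <#> V \<subseteq> U" using open_square_within N by metis
  have "lie_nhd C V <#>\<^bsub>LG\<^esub> lie_nhd C V \<subseteq> N"
    using V(3) N(1) by (force simp: set_mult_def lie_nhd_def)
  then show "\<exists>M\<in>lie_basis. M <#>\<^bsub>LG\<^esub> M \<subseteq> N" using V N by blast
  let ?V = "{x \<in> topspace T. inv x \<in> U}"
  have "openin T ?V" by (rule openin_continuous_map_preimage[OF continuous_inv N(3)])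
  moreover have "\<one> \<in> ?V" using N by (simp add: topspace_eq)
  moreover have "\<forall>f\<in>lie_nhd C ?V. inv\<^bsub>LG\<^esub> f \<in> N" by (auto simp: N lie_nhd_def lie_inv)
  ultimately show "\<exists>M\<in>lie_basis. \<forall>f\<in>M. inv\<^bsub>LG\<^esub> f \<in> N" using N(2) by blast
qed

sublocale LG: basis_at_identity LG TL lie_basis
  by (rule basis_at_identity_lie)

lemma topological_comm_group_lie: "topological_comm_group LG TL"
proof (rule LG.topological_comm_group_basis)
  have "f = \<one>\<^bsub>LG\<^esub>" if f: "f \<in> \<Inter>lie_basis" for f
  proof
    fix t
    have fc: "f \<in> carrier LG" using f LG.basis_nonempty LG.basis_subset by blast
    show "f t = \<one>\<^bsub>LG\<^esub> t"
    proof (rule ccontr)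
      assume ne: "f t \<noteq> \<one>\<^bsub>LG\<^esub> t"
      have "closedin T {f t}"
        using lie_closed[OF fc, of t] Hausdorff by (simp add: closedin_Hausdorff_singleton topspace_eq)
      then have "openin T (topspace T - {f t})" by blast
      moreover have "\<one> \<in> topspace T - {f t}" using ne by (auto simp: topspace_eq)
      moreover have "compact {t}" by simp
      ultimately have "lie_nhd {t} (topspace T - {f t}) \<in> lie_basis" by blast
      then have "f \<in> lie_nhd {t} (topspace T - {f t})" using f by blast
      then show False by (simp add: lie_nhd_def)
    qed
  qed
  then show "\<Inter>lie_basis = {\<one>\<^bsub>LG\<^esub>}" using LG.one_in_basis by blast
qed

lemma continuous_map_lie_eval: "continuous_map TL T (\<lambda>f. f t)"
  unfolding continuous_map
proof (intro conjI allI impI)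
  show "(\<lambda>f. f t) ` topspace TL \<subseteq> topspace T"
    by (auto simp: LG.topspace_eq_carrier topspace_eq lie_closed)
  fix U assume U: "openin T U"
  show "openin TL {f \<in> topspace TL. f t \<in> U}"
    unfolding LG.openin_iff
  proof (intro conjI ballI)
    show "{f \<in> topspace TL. f t \<in> U} \<subseteq> carrier LG" by (auto simp: LG.topspace_eq_carrier)
    fix f assume "f \<in> {f \<in> topspace TL. f t \<in> U}"
    then have f: "f \<in> carrier LG" "f t \<in> U" by (auto simp: LG.topspace_eq_carrier)
    let ?V = "{x \<in> topspace T. f t \<otimes> x \<in> U}"
    have "openin T ?V"
      using f by (intro openin_continuous_map_preimage[OF continuous_map_translation U] lie_closed)
    moreover have "\<one> \<in> ?V" using f by (simp add: topspace_eq lie_closed)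
    moreover have "compact {t}" by simp
    ultimately have "lie_nhd {t} ?V \<in> lie_basis" by blast
    moreover have "f <#\<^bsub>LG\<^esub> lie_nhd {t} ?V \<subseteq> {f \<in> topspace TL. f t \<in> U}"
      using f by (auto simp: l_coset_def lie_nhd_def LG.topspace_eq_carrier)
    ultimately show "\<exists>N\<in>lie_basis. f <#\<^bsub>LG\<^esub> N \<subseteq> {f \<in> topspace TL. f t \<in> U}" by blast
  qed
qed

lemma lie_scale_closed:
  assumes "f \<in> carrier LG"
  shows "lie_scale c f \<in> carrier LG"
proof (rule lie_memI)
  have "continuous_map euclideanreal euclideanreal (\<lambda>t. c * t)" by (simp add: continuous_on_mult_left)
  from continuous_map_compose[OF this lie_continuous[OF assms]]
  show "continuous_map euclideanreal T (lie_scale c f)" by (simp add: o_def lie_scale_def)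
qed (use assms in \<open>auto simp: lie_scale_def lie_closed lie_add distrib_left\<close>)

text \<open>A linear combination in the real vector space of one-parameter subgroups, written multiplicatively.\<close>

definition lie_comb :: "(real \<Rightarrow> 'a) set \<Rightarrow> ((real \<Rightarrow> 'a) \<Rightarrow> real) \<Rightarrow> real \<Rightarrow> 'a" where
  "lie_comb B c = finprod LG (\<lambda>b. lie_scale (c b) b) B"

lemma lie_comb_apply:
  assumes "finite B" "B \<subseteq> carrier LG"
  shows "lie_comb B c t = (\<Otimes>b\<in>B. b (c b * t))"
  using assms
proof (induction B)
  case empty
  then show ?case by (simp add: lie_comb_def)
next
  case (insert b B)
  then have "(\<lambda>b. lie_scale (c b) b) \<in> B \<rightarrow> carrier LG" "lie_scale (c b) b \<in> carrier LG"
    by (auto intro: lie_scale_closed)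
  then have "lie_comb (insert b B) c = lie_scale (c b) b \<otimes>\<^bsub>LG\<^esub> lie_comb B c"
    using insert by (simp add: lie_comb_def LG.finprod_insert)
  moreover have "(\<Otimes>b\<in>insert b B. b (c b * t)) = b (c b * t) \<otimes> (\<Otimes>b\<in>B. b (c b * t))"
    using insert by (intro finprod_insert) (auto simp: lie_closed)
  ultimately show ?case using insert by (simp add: lie_scale_def)
qed

lemma lie_comb_closed:
  assumes "B \<subseteq> carrier LG"
  shows "lie_comb B c \<in> carrier LG"
  unfolding lie_comb_def using assms by (intro LG.finprod_closed) (auto intro: lie_scale_closed)

lemma lie_comb_cong:
  assumes "finite B" "B \<subseteq> carrier LG" "\<And>b. b \<in> B \<Longrightarrow> c b = d b"
  shows "lie_comb B c = lie_comb B d"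
  using assms by (auto simp: fun_eq_iff lie_comb_apply intro!: finprod_cong' lie_closed)

lemma lie_comb_add:
  assumes "finite B" "B \<subseteq> carrier LG"
  shows "lie_comb B c \<otimes>\<^bsub>LG\<^esub> lie_comb B d = lie_comb B (\<lambda>b. c b + d b)"
proof
  fix t
  have "(\<Otimes>b\<in>B. b (c b * t)) \<otimes> (\<Otimes>b\<in>B. b (d b * t)) = (\<Otimes>b\<in>B. b (c b * t) \<otimes> b (d b * t))"
    using assms by (intro finprod_multf[symmetric]) (auto simp: lie_closed)
  also have "\<dots> = (\<Otimes>b\<in>B. b ((c b + d b) * t))"
    using assms by (intro finprod_cong') (auto simp: lie_closed lie_add distrib_right subset_iff)
  finally show "(lie_comb B c \<otimes>\<^bsub>LG\<^esub> lie_comb B d) t = lie_comb B (\<lambda>b. c b + d b) t"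
    using assms by (simp add: lie_comb_apply)
qed

lemma lie_comb_scale:
  assumes "finite B" "B \<subseteq> carrier LG"
  shows "lie_scale s (lie_comb B c) = lie_comb B (\<lambda>b. s * c b)"
  using assms by (auto simp: fun_eq_iff lie_comb_apply lie_scale_def mult_ac)

definition lie_spanning :: "(real \<Rightarrow> 'a) set \<Rightarrow> bool" where
  "lie_spanning B \<longleftrightarrow> finite B \<and> B \<subseteq> carrier LG \<and> (\<forall>f\<in>carrier LG. \<exists>c. f = lie_comb B c)"

text \<open>A nontrivial relation would express one member of the spanning set by the others: subtracting the
  right multiple of the relation from any combination removes that member.\<close>

lemma minimal_spanning_independent:
  assumes B: "lie_spanning B" and minimal: "\<And>B'. lie_spanning B' \<Longrightarrow> card B \<le> card B'"
    and c: "lie_comb B c = \<one>\<^bsub>LG\<^esub>" and b: "b \<in> B"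
  shows "c b = 0"
proof (rule ccontr)
  assume nz: "c b \<noteq> 0"
  have fin: "finite B" "B \<subseteq> carrier LG" using B by (auto simp: lie_spanning_def)
  let ?B = "B - {b}"
  have "\<exists>d. f = lie_comb ?B d" if f: "f \<in> carrier LG" for f
  proof -
    obtain d where d: "f = lie_comb B d" using B f by (auto simp: lie_spanning_def)
    define s where "s = - (d b / c b)"
    let ?d = "\<lambda>a. d a + s * c a"
    have "lie_scale s \<one>\<^bsub>LG\<^esub> = \<one>\<^bsub>LG\<^esub>" by (simp add: lie_scale_def fun_eq_iff)
    then have "f = f \<otimes>\<^bsub>LG\<^esub> lie_scale s (lie_comb B c)" using f c by simp
    then have f': "f = lie_comb B ?d" using fin by (simp add: d lie_comb_scale lie_comb_add)
    have "?d b = 0" using nz by (simp add: s_def)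
    have "f t = lie_comb ?B ?d t" for t
    proof -
      have "f t = (\<Otimes>a\<in>insert b ?B. a (?d a * t))"
        using b fin by (subst f') (simp add: lie_comb_apply insert_absorb)
      also have "\<dots> = b (?d b * t) \<otimes> (\<Otimes>a\<in>?B. a (?d a * t))"
        using fin b by (intro finprod_insert) (auto simp: lie_closed)
      also have "b (?d b * t) = \<one>" using \<open>?d b = 0\<close> lie_zero b fin by (simp add: subset_iff)
      also have "\<one> \<otimes> (\<Otimes>a\<in>?B. a (?d a * t)) = (\<Otimes>a\<in>?B. a (?d a * t))"
        using fin by (intro l_one finprod_closed) (auto simp: lie_closed)
      finally show ?thesis using fin by (subst lie_comb_apply) auto
    qed
    then show ?thesis by blast
  qed
  then have "lie_spanning ?B" using fin by (auto simp: lie_spanning_def)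
  from minimal[OF this] show False using card_Diff1_less[OF fin(1) b] by simp
qed

text \<open>It is enough to control a combination at time \<open>1\<close>: its value at time \<open>t\<close> is the value at time \<open>1\<close> of the
  combination with coefficients scaled by \<open>t\<close>.\<close>

lemma lie_comb_small:
  assumes "finite B" "B \<subseteq> carrier LG" "openin T U" "\<one> \<in> U"
  shows "\<exists>\<delta>>0. \<forall>c. (\<forall>b\<in>B. \<bar>c b\<bar> < \<delta>) \<longrightarrow> lie_comb B c 1 \<in> U"
  using assms
proof (induction B arbitrary: U)
  case empty
  then show ?case by (auto simp: lie_comb_apply intro: exI[of _ 1])
next
  case (insert b B)
  obtain V where V: "openin T V" "\<one> \<in> V" "V <#> V \<subseteq> U" using open_square_within insert by metis
  obtain \<delta> where \<delta>: "\<delta> > 0" "\<forall>c. (\<forall>b\<in>B. \<bar>c b\<bar> < \<delta>) \<longrightarrow> lie_comb B c 1 \<in> V"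
    using insert.IH[of V] insert.prems V by auto
  have b: "b \<in> carrier LG" using insert by simp
  have "open {t. b t \<in> V}"
    using openin_continuous_map_preimage[OF lie_continuous[OF b] V(1)] by simp
  moreover have "0 \<in> {t. b t \<in> V}" using V lie_zero[OF b] by simp
  ultimately obtain e where e: "e > 0" "\<And>t. \<bar>t\<bar> < e \<Longrightarrow> b t \<in> V"
    unfolding open_dist by (auto simp: dist_real_def)
  show ?case
  proof (intro exI[of _ "min \<delta> e"] conjI allI impI)
    show "0 < min \<delta> e" using \<delta> e by simp
    fix c assume c: "\<forall>a\<in>insert b B. \<bar>c a\<bar> < min \<delta> e"
    have "lie_comb (insert b B) c 1 = b (c b * 1) \<otimes> lie_comb B c 1"
      using insert by (simp add: lie_comb_apply) (intro finprod_insert; auto simp: lie_closed)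
    moreover have "b (c b * 1) \<in> V" "lie_comb B c 1 \<in> V" using c e(2)[of "c b"] \<delta> by auto
    ultimately show "lie_comb (insert b B) c 1 \<in> U" using V(3) by (auto simp: set_mult_def)
  qed
qed

text \<open>Taking a symmetric interval for the compact set makes the neighbourhood balanced, that is, stable
  under scaling by factors of absolute value at most \<open>1\<close>.\<close>

lemma lie_nhd_interval:
  assumes "N \<in> lie_basis"
  obtains r U where "r > 0" "openin T U" "\<one> \<in> U" "lie_nhd {-r..r} U \<subseteq> N"
proof -
  obtain C U where N: "N = lie_nhd C U" "compact C" "openin T U" "\<one> \<in> U" using assms by blast
  obtain r where "r > 0" "\<forall>t\<in>C. norm t \<le> r" using compact_imp_bounded[OF N(2)] bounded_pos by metis
  then have "C \<subseteq> {-r..r}" by (auto simp: abs_le_iff)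
  then show thesis using that[OF \<open>r > 0\<close> N(3,4)] N(1) by (auto simp: lie_nhd_def)
qed

abbreviation "cube B \<equiv> product_topology (\<lambda>_. top_of_set {-1..1::real}) B"

lemma continuous_lie_comb:
  assumes fin: "finite B" "B \<subseteq> carrier LG"
  shows "continuous_map (cube B) TL (lie_comb B)"
proof (rule LG.continuous_map_if_close)
  show "lie_comb B \<in> topspace (cube B) \<rightarrow> carrier LG" using lie_comb_closed fin by blast
  fix c N assume c: "c \<in> topspace (cube B)" and N: "N \<in> lie_basis"
  obtain r U where r: "r > 0" "openin T U" "\<one> \<in> U" "lie_nhd {-r..r} U \<subseteq> N"
    using lie_nhd_interval[OF N] .
  obtain \<delta> where \<delta>: "\<delta> > 0" "\<And>d. (\<forall>b\<in>B. \<bar>d b\<bar> < \<delta>) \<Longrightarrow> lie_comb B d 1 \<in> U"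
    using lie_comb_small[OF fin r(2,3)] by blast
  \<comment> \<open>the radius absorbs the factor \<open>t\<close> with \<open>\<bar>t\<bar> \<le> r\<close> that appears when time \<open>t\<close> is moved to time 1\<close>
  let ?W = "Pi\<^sub>E B (\<lambda>b. {-1..1} \<inter> ball (c b) (\<delta> / r))"
  have "openin (cube B) ?W"
    using fin by (auto simp: openin_PiE openin_open_Int)
  moreover have "c \<in> ?W" using c \<delta> r by (auto simp: PiE_iff)
  moreover have "lie_comb B d \<in> lie_comb B c <#\<^bsub>LG\<^esub> N" if d: "d \<in> ?W" for d
  proof -
    let ?e = "\<lambda>b. d b + (-1) * c b"
    have "lie_comb B ?e \<in> lie_nhd {-r..r} U"
      unfolding lie_nhd_def
    proof (intro CollectI conjI ballI lie_comb_closed fin)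
      fix t assume t: "t \<in> {-r..r}"
      have "\<bar>t * ?e b\<bar> < \<delta>" if "b \<in> B" for b
      proof -
        have "\<bar>?e b\<bar> < \<delta> / r" using d \<open>b \<in> B\<close> by (auto simp: PiE_iff dist_real_def abs_minus_commute)
        then have "\<bar>t\<bar> * \<bar>?e b\<bar> \<le> r * \<bar>?e b\<bar>" "r * \<bar>?e b\<bar> < \<delta>"
          using t r by (auto simp: field_simps intro!: mult_right_mono)
        then show ?thesis by (simp add: abs_mult)
      qed
      then have "lie_comb B (\<lambda>b. t * ?e b) 1 \<in> U" using \<delta>(2)[of "\<lambda>b. t * ?e b"] by simp
      then show "lie_comb B ?e t \<in> U" using fin by (simp add: lie_comb_apply mult.commute)
    qed
    then have "lie_comb B ?e \<in> N" using r by blast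
    moreover have "lie_comb B c \<otimes>\<^bsub>LG\<^esub> lie_comb B ?e = lie_comb B d"
      using fin by (subst lie_comb_add) auto
    ultimately show ?thesis unfolding l_coset_def by (intro UN_I[of "lie_comb B ?e"]) simp_all
  qed
  ultimately show "\<exists>W. openin (cube B) W \<and> c \<in> W \<and> (\<forall>d\<in>W. lie_comb B d \<in> lie_comb B c <#\<^bsub>LG\<^esub> N)"
    by blast
qed

lemma locally_compact_if_identity:
  assumes "openin T V" "\<one> \<in> V" "compactin T Q" "V \<subseteq> Q"
  shows "locally_compact_space T"
  unfolding locally_compact_space_def
proof
  fix x assume "x \<in> topspace T"
  then have x: "x \<in> carrier G" by (simp add: topspace_eq)
  let ?V = "{y \<in> topspace T. inv x \<otimes> y \<in> V}"
  have "openin T ?V" using openin_continuous_map_preimage[OF continuous_map_translation assms(1)] x by simp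
  moreover have "compactin T ((\<lambda>y. x \<otimes> y) ` Q)"
    by (rule image_compactin[OF assms(3) continuous_map_translation[OF x]])
  moreover have "x \<in> ?V" using x assms by (simp add: topspace_eq)
  moreover have "?V \<subseteq> (\<lambda>y. x \<otimes> y) ` Q"
  proof
    fix y assume y: "y \<in> ?V"
    then have "y = x \<otimes> (inv x \<otimes> y)" using x by (simp add: topspace_eq m_assoc[symmetric])
    then show "y \<in> (\<lambda>y. x \<otimes> y) ` Q" using y assms(4) by blast
  qed
  ultimately show "\<exists>U K. openin T U \<and> compactin T K \<and> x \<in> U \<and> U \<subseteq> K" by blast
qed

text \<open>Take a spanning set \<open>B\<close> of least size, so that by independence the combinations with coefficients on
  the boundary of the cube form a compact set that misses the origin. A balanced neighbourhood \<open>?N\<close> of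
  the origin avoids this set. A combination in \<open>?N\<close> whose coefficients leave the cube could be scaled
  down to the boundary while staying in \<open>?N\<close>; so \<open>?N\<close> is contained in the compact image of the cube.\<close>

lemma locally_compact_lie:
  assumes "finite_dimensional G T"
  shows "locally_compact_space TL"
proof -
  interpret TL: topological_comm_group LG TL by (rule topological_comm_group_lie)
  have "\<exists>B. lie_spanning B"
    using assms by (simp add: finite_dimensional_def lie_spanning_def lie_comb_def)
  then obtain B where B: "lie_spanning B" and minimal: "\<And>B'. lie_spanning B' \<Longrightarrow> card B \<le> card B'"
    using ex_has_least_nat[of lie_spanning _ card] by blast
  have fin: "finite B" "B \<subseteq> carrier LG" using B by (auto simp: lie_spanning_def)
  have "compact_space (top_of_set {-1..1::real})" by (simp add: compact_space_subtopology)
  then have cube_compact: "compact_space (cube B)"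
    unfolding compact_space_product_topology by blast
  let ?S = "{c \<in> topspace (cube B). \<exists>b\<in>B. \<bar>c b\<bar> = 1}"
  have abs1: "\<bar>x\<bar> = 1 \<longleftrightarrow> x \<in> {-1, 1}" for x :: real by (auto simp: abs_if)
  have "closedin (cube B) (\<Union>b\<in>B. {c \<in> topspace (cube B). c b \<in> {-1, 1}})"
  proof (rule closedin_Union)
    fix A assume "A \<in> (\<lambda>b. {c \<in> topspace (cube B). c b \<in> {-1, 1}}) ` B"
    then obtain b where b: "b \<in> B" "A = {c \<in> topspace (cube B). c b \<in> {-1, 1}}" by blast
    have "closedin (top_of_set {-1..1::real}) {-1, 1}" by (auto intro: closed_subset)
    then show "closedin (cube B) A"
      unfolding b(2)
      by (rule closedin_continuous_map_preimage[rotated])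
        (use continuous_map_product_projection[OF b(1), of "\<lambda>_. top_of_set {-1..1::real}"] in simp)
  qed (use fin in simp)
  moreover have "(\<Union>b\<in>B. {c \<in> topspace (cube B). c b \<in> {-1, 1}}) = ?S"
    unfolding abs1 by blast
  ultimately have "compactin (cube B) ?S" using cube_compact by (simp add: closedin_compact_space)
  then have "compactin TL (lie_comb B ` ?S)" by (rule image_compactin[OF _ continuous_lie_comb[OF fin]])
  then have "closedin TL (lie_comb B ` ?S)" using TL.Hausdorff by (rule compactin_imp_closedin[rotated])
  then have "openin TL (carrier LG - lie_comb B ` ?S)"
    using LG.topspace_eq_carrier by (simp add: closedin_def)
  moreover have "\<one>\<^bsub>LG\<^esub> \<notin> lie_comb B ` ?S"
    using minimal_spanning_independent[OF B minimal] by force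
  ultimately obtain N where N: "N \<in> lie_basis" "\<one>\<^bsub>LG\<^esub> <#\<^bsub>LG\<^esub> N \<subseteq> carrier LG - lie_comb B ` ?S"
    unfolding LG.openin_iff by blast
  obtain r U where r: "r > 0" "openin T U" "\<one> \<in> U" "lie_nhd {-r..r} U \<subseteq> N"
    using lie_nhd_interval[OF N(1)] .
  let ?N = "lie_nhd {-r..r} U"
  have N': "?N \<in> lie_basis" using r by (auto intro!: exI[of _ "{-r..r}"] exI[of _ U])
  have disj: "?N \<inter> lie_comb B ` ?S = {}"
    using N r LG.lcos_mult_one[OF LG.basis_subset[OF N(1)]] by blast
  have "?N \<subseteq> lie_comb B ` topspace (cube B)"
  proof
    fix f assume f: "f \<in> ?N"
    then obtain c where c: "f = lie_comb B c" using B by (auto simp: lie_spanning_def lie_nhd_def)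
    show "f \<in> lie_comb B ` topspace (cube B)"
    proof (cases "\<forall>b\<in>B. \<bar>c b\<bar> \<le> 1")
      case True
      then have "restrict c B \<in> topspace (cube B)" by (auto simp: PiE_iff abs_le_iff)
      moreover have "f = lie_comb B (restrict c B)" unfolding c by (rule lie_comb_cong[OF fin]) simp
      ultimately show ?thesis by blast
    next
      case False
      then have ne: "B \<noteq> {}" by blast
      define m where "m = Max ((\<lambda>b. \<bar>c b\<bar>) ` B)"
      have le: "\<bar>c b\<bar> \<le> m" if "b \<in> B" for b using fin that by (simp add: m_def)
      have m: "m > 1" using False le by force
      have "m \<in> (\<lambda>b. \<bar>c b\<bar>) ` B" unfolding m_def using fin ne by (intro Max_in) auto
      then obtain b where b: "b \<in> B" "\<bar>c b\<bar> = m" by blast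
      let ?d = "restrict (\<lambda>b. (1/m) * c b) B"
      have "- 1 \<le> c a / m \<and> c a / m \<le> 1" if "a \<in> B" for a
      proof -
        have "\<bar>c a / m\<bar> \<le> 1" using le[OF that] m by simp
        then show ?thesis by linarith
      qed
      then have "?d \<in> topspace (cube B)" by simp
      moreover have "\<bar>?d b\<bar> = 1" using m b by simp
      ultimately have "?d \<in> ?S" using b(1) by blast
      have "lie_scale (1/m) f = lie_comb B ?d"
        unfolding c lie_comb_scale[OF fin] by (rule lie_comb_cong[OF fin]) simp
      then have "lie_scale (1/m) f \<in> lie_comb B ` ?S" using \<open>?d \<in> ?S\<close> by (rule image_eqI)
      moreover have "lie_scale (1/m) f \<in> ?N"
        unfolding lie_nhd_def
      proof (intro CollectI conjI ballI lie_scale_closed)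
        show "f \<in> carrier LG" using f by (simp add: lie_nhd_def)
        fix t assume t: "t \<in> {-r..r}"
        have "\<bar>t / m\<bar> \<le> \<bar>t\<bar>" using m by (simp add: divide_le_eq mult_le_cancel_left1)
        then have "t / m \<in> {-r..r}" using t unfolding atLeastAtMost_iff by linarith
        then show "lie_scale (1/m) f t \<in> U" using f by (simp add: lie_scale_def lie_nhd_def)
      qed
      ultimately show ?thesis using disj by blast
    qed
  qed
  moreover obtain V where V: "openin TL V" "\<one>\<^bsub>LG\<^esub> \<in> V" "V \<subseteq> \<one>\<^bsub>LG\<^esub> <#\<^bsub>LG\<^esub> ?N"
    using LG.open_nhd_within_coset[OF LG.one_closed N'] .
  ultimately have "V \<subseteq> lie_comb B ` topspace (cube B)"
    using LG.lcos_mult_one[OF LG.basis_subset[OF N']] by simp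
  moreover have "compactin TL (lie_comb B ` topspace (cube B))"
    using image_compactin[OF _ continuous_lie_comb[OF fin]] cube_compact by (simp add: compact_space_def)
  ultimately show ?thesis using V TL.locally_compact_if_identity by blast
qed

end

section \<open>The exponential map of a torus-free group is injective\<close>

text \<open>If there were arbitrarily small positive elements, their multiples would make the group dense. So
  there is a least positive element, and division with remainder by it leaves remainder zero.\<close>

lemma closed_subgroup_of_reals:
  fixes K :: "real set"
  assumes "closed K" and diff: "\<And>x y. x \<in> K \<Longrightarrow> y \<in> K \<Longrightarrow> x - y \<in> K"
    and "K \<noteq> UNIV" and p: "p \<in> K" "p > 0"
  obtains a where "a > 0" "\<And>t. t * a \<in> K \<longleftrightarrow> t \<in> \<int>"
proof -
  have zero: "0 \<in> K" using diff[OF p(1) p(1)] by simp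
  have add: "x + y \<in> K" if "x \<in> K" "y \<in> K" for x y
    using diff[OF that(1) diff[OF zero that(2)]] by simp
  have mult: "of_int n * x \<in> K" if "x \<in> K" for n x
  proof -
    have nat: "of_nat m * x \<in> K" for m
      using that zero add by (induction m) (auto simp: distrib_right add.commute)
    show ?thesis
      by (cases n rule: int_cases2) (use nat diff[OF zero nat] in simp_all)
  qed
  have "\<exists>e>0. \<forall>x\<in>K. x > 0 \<longrightarrow> e \<le> x"
  proof (rule ccontr)
    assume "\<not> ?thesis"
    then have small: "\<exists>x\<in>K. 0 < x \<and> x < e" if "e > 0" for e using that by (meson not_le)
    have "t \<in> closure K" for t
      unfolding closure_approachable
    proof (intro allI impI)
      fix e :: real assume "0 < e"
      then obtain x where x: "x \<in> K" "0 < x" "x < e" using small by blast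
      have "of_int \<lfloor>t / x\<rfloor> * x \<le> t" using x by (simp add: pos_le_divide_eq[symmetric])
      moreover have "t < (of_int \<lfloor>t / x\<rfloor> + 1) * x" using x by (simp add: pos_divide_less_eq[symmetric])
      ultimately have "dist (of_int \<lfloor>t / x\<rfloor> * x) t < e"
        using x by (simp add: dist_real_def distrib_right)
      then show "\<exists>y\<in>K. dist y t < e" using mult[OF x(1)] by blast
    qed
    then show False using assms(1,3) by auto
  qed
  then obtain e where e: "e > 0" "\<And>x. x \<in> K \<Longrightarrow> x > 0 \<Longrightarrow> e \<le> x" by blast
  define a where "a = Inf (K \<inter> {e..})"
  have bdd: "bdd_below (K \<inter> {e..})" by (rule bdd_belowI[of _ e]) auto
  have "a \<in> K \<inter> {e..}"
    unfolding a_def using e p assms(1) bdd by (intro closed_contains_Inf closed_Int) auto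
  then have a: "a \<in> K" "a > 0" using e by auto
  have least: "a \<le> x" if "x \<in> K" "x > 0" for x
    unfolding a_def using that e bdd by (intro cInf_lower) auto
  have "t \<in> \<int>" if "t * a \<in> K" for t
  proof -
    let ?r = "t * a - of_int \<lfloor>t\<rfloor> * a"
    have "?r \<in> K" using that mult[OF a(1)] diff by blast
    moreover have "?r < a"
    proof -
      have "(t - of_int \<lfloor>t\<rfloor>) * a < 1 * a" using a by (intro mult_strict_right_mono) linarith+
      then show ?thesis by (simp add: left_diff_distrib)
    qed
    moreover have "?r \<ge> 0" using a by (simp add: mult_right_mono)
    ultimately have "?r = 0" using least[of ?r] by linarith
    then have "t = of_int \<lfloor>t\<rfloor>" using a by simp
    then show ?thesis by (metis Ints_of_int)
  qed
  moreover have "t * a \<in> K" if "t \<in> \<int>" for t using that mult[OF a(1)] by (auto elim: Ints_cases)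
  ultimately show thesis using that[OF a(2)] by blast
qed

lemma compact_space_circle: "compact_space (coset_topology real_group euclideanreal \<int>)"
proof -
  let ?q = "\<lambda>x. \<int> #>\<^bsub>real_group\<^esub> x"
  have "continuous_map euclideanreal (coset_topology real_group euclideanreal \<int>) ?q"
    unfolding coset_topology_def by (intro quotient_imp_continuous_map quotient_map_quotient_topology)
  then have "compactin (coset_topology real_group euclideanreal \<int>) (?q ` {0..1})"
    by (intro image_compactin[of euclideanreal]) auto
  moreover have "?q x \<in> ?q ` {0..1}" for x
  proof (rule image_eqI)
    show "?q x = ?q (frac x)" by (simp add: Ints_coset_eq_iff frac_def)
    show "frac x \<in> {0..1}" using frac_ge_0[of x] frac_lt_1[of x] by simp
  qed
  then have "?q ` {0..1} = topspace (coset_topology real_group euclideanreal \<int>)"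
    unfolding coset_topology_def topspace_quotient_topology by auto
  ultimately show ?thesis by (simp add: compact_space_def)
qed

context topological_comm_group
begin

text \<open>A one-parameter subgroup with kernel the integers factors through an injective continuous
  homomorphism \<open>F\<close> on the circle. As the circle is compact and \<open>G\<close> is Hausdorff, \<open>F\<close> is a homeomorphism
  onto its image.\<close>

lemma image_is_torus_if_kernel_Ints:
  assumes g: "g \<in> carrier LG" and ker: "\<And>t. g t = \<one> \<longleftrightarrow> t \<in> \<int>"
  shows "subgroup (range g) G" "is_torus (G\<lparr>carrier := range g\<rparr>) (subtopology T (range g))"
proof -
  let ?q = "\<lambda>x. \<int> #>\<^bsub>real_group\<^esub> x"
  let ?S = "coset_topology real_group euclideanreal \<int>"
  interpret g: group_hom real_group G g
    using g by (intro group_hom.intro group_hom_axioms.intro real_group.is_group is_group)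
      (simp add: lie_group_def)
  show sub: "subgroup (range g) G" using g.img_is_subgroup by simp
  have eq: "g s = g t \<longleftrightarrow> ?q s = ?q t" for s t
  proof -
    have "g s = g t \<longleftrightarrow> g (s - t) = \<one>"
    proof -
      have "g s = g (s - t) \<otimes> g t" using lie_add[OF g, of "s - t" t] by simp
      then show ?thesis using lie_closed[OF g] by simp
    qed
    then show ?thesis by (simp only: ker Ints_coset_eq_iff)
  qed
  \<comment> \<open>the map induced on the circle; \<open>F\<close> below is the same map on the one-coordinate product\<close>
  define F' where "F' c = g (SOME x. ?q x = c)" for c
  have F'q: "F' (?q x) = g x" for x
    unfolding F'_def eq by (rule someI[of _ x]) simp
  have "continuous_map euclideanreal T (F' \<circ> ?q)"
    using lie_continuous[OF g] by (simp add: o_def F'q)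
  then have F'cont: "continuous_map ?S T F'"
    unfolding coset_topology_def by (rule continuous_compose_quotient_map[OF quotient_map_quotient_topology])
  define F where "F u = F' (u 0)" for u :: "nat \<Rightarrow> real set"
  have carr: "carrier (torus_group 1) = (\<Pi>\<^sub>E i\<in>{..<1}. range ?q)"
    by (simp add: torus_group_def carrier_FactGroup)
  have top: "topspace (torus_topology 1) = (\<Pi>\<^sub>E i\<in>{..<1}. range ?q)"
    by (simp add: torus_topology_def coset_topology_def topspace_quotient_topology)
  have "continuous_map (torus_topology 1) ?S (\<lambda>u. u 0)"
    unfolding torus_topology_def
    by (rule continuous_map_product_projection) simp
  from continuous_map_compose[OF this F'cont]
  have Fcont: "continuous_map (torus_topology 1) T F" by (simp add: o_def F_def[abs_def])
  have coord: "\<exists>x. u 0 = ?q x" if "u \<in> (\<Pi>\<^sub>E i\<in>{..<1::nat}. range ?q)" for u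
    using PiE_mem[OF that, of 0] by auto
  have img: "F ` (\<Pi>\<^sub>E i\<in>{..<1::nat}. range ?q) = range g"
  proof
    have "F u \<in> range g" if "u \<in> (\<Pi>\<^sub>E i\<in>{..<1::nat}. range ?q)" for u
      using coord[OF that] by (auto simp: F_def F'q)
    then show "F ` (\<Pi>\<^sub>E i\<in>{..<1::nat}. range ?q) \<subseteq> range g" by blast
    show "range g \<subseteq> F ` (\<Pi>\<^sub>E i\<in>{..<1::nat}. range ?q)"
    proof clarify
      fix x
      have "g x = F (\<lambda>i\<in>{..<1}. ?q x)" by (simp add: F_def F'q)
      then show "g x \<in> F ` (\<Pi>\<^sub>E i\<in>{..<1::nat}. range ?q)"
        by (rule image_eqI[where f = F]) simp
    qed
  qed
  have inj: "inj_on F (\<Pi>\<^sub>E i\<in>{..<1::nat}. range ?q)"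
  proof (rule inj_onI)
    fix u v assume u: "u \<in> (\<Pi>\<^sub>E i\<in>{..<1::nat}. range ?q)" and v: "v \<in> (\<Pi>\<^sub>E i\<in>{..<1::nat}. range ?q)"
      and "F u = F v"
    moreover obtain x y where "u 0 = ?q x" "v 0 = ?q y" using coord[OF u] coord[OF v] by blast
    ultimately have "u 0 = v 0" by (simp add: F_def F'q eq)
    then show "u = v" using u v by (intro extensionalityI[of _ "{..<1::nat}"]) (auto simp: PiE_iff)
  qed
  have "homeomorphic_map (torus_topology 1) (subtopology T (range g)) F"
  proof (rule continuous_imp_homeomorphic_map)
    show "compact_space (torus_topology 1)"
      unfolding torus_topology_def compact_space_product_topology using compact_space_circle by blast
    show "Hausdorff_space (subtopology T (range g))" using Hausdorff by (rule Hausdorff_space_subtopology)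
    show "continuous_map (torus_topology 1) (subtopology T (range g)) F"
      unfolding continuous_map_in_subtopology top using Fcont img by blast
    show "F ` topspace (torus_topology 1) = topspace (subtopology T (range g))"
      unfolding top img using lie_closed[OF g] by (auto simp: topspace_eq)
    show "inj_on F (topspace (torus_topology 1))" unfolding top by (rule inj)
  qed
  then obtain F1 where F1: "homeomorphic_maps (torus_topology 1) (subtopology T (range g)) F F1"
    by (auto simp: homeomorphic_map_maps)
  interpret torus: group "torus_group 1" by (rule group_torus_group)
  have "F \<in> iso (torus_group 1) (G\<lparr>carrier := range g\<rparr>)"
  proof (rule isoI)
    show "bij_betw F (carrier (torus_group 1)) (carrier (G\<lparr>carrier := range g\<rparr>))"
      unfolding bij_betw_def carr using inj img by simp
    show "F \<in> hom (torus_group 1) (G\<lparr>carrier := range g\<rparr>)"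
    proof (rule homI)
      show "F u \<in> carrier (G\<lparr>carrier := range g\<rparr>)" if "u \<in> carrier (torus_group 1)" for u
        using that img unfolding carr by auto
      fix u v assume "u \<in> carrier (torus_group 1)" "v \<in> carrier (torus_group 1)"
      then obtain x y where xy: "u 0 = ?q x" "v 0 = ?q y" unfolding carr using coord by meson
      then have "(u \<otimes>\<^bsub>torus_group 1\<^esub> v) 0 = ?q (x + y)"
        by (simp add: torus_group_def Ints_coset_mult)
      then show "F (u \<otimes>\<^bsub>torus_group 1\<^esub> v) = F u \<otimes>\<^bsub>G\<lparr>carrier := range g\<rparr>\<^esub> F v"
        using xy lie_add[OF g] by (simp add: F_def F'q)
    qed
  qed
  then have iso: "inv_into (carrier (torus_group 1)) F \<in> iso (G\<lparr>carrier := range g\<rparr>) (torus_group 1)"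
    by (rule torus.iso_set_sym)
  have "homeomorphic_map (subtopology T (range g)) (torus_topology 1) F1"
    using F1 by (simp add: homeomorphic_maps_map)
  then have "homeomorphic_map (subtopology T (range g)) (torus_topology 1) (inv_into (carrier (torus_group 1)) F)"
  proof (rule homeomorphic_map_eq)
    fix y assume y: "y \<in> topspace (subtopology T (range g))"
    have "F1 y \<in> topspace (torus_topology 1)" "F (F1 y) = y"
      using F1 y by (auto simp: homeomorphic_maps_def continuous_map_def)
    then show "F1 y = inv_into (carrier (torus_group 1)) F y"
      using inj by (metis carr inv_into_f_f top)
  qed
  with iso show "is_torus (G\<lparr>carrier := range g\<rparr>) (subtopology T (range g))"
    unfolding is_torus_def topgroup_isomorphic_def by blast
qed

lemma lie_exp_eq_one_imp_trivial:
  assumes tf: "torus_free G T" and f: "f \<in> carrier LG" and f1: "f 1 = \<one>"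
  shows "f = \<one>\<^bsub>LG\<^esub>"
proof (rule ccontr)
  assume ne: "f \<noteq> \<one>\<^bsub>LG\<^esub>"
  let ?K = "{t. f t = \<one>}"
  have "closedin T {\<one>}" using Hausdorff by (simp add: closedin_Hausdorff_singleton topspace_eq)
  then have "closedin euclideanreal {t \<in> topspace euclideanreal. f t \<in> {\<one>}}"
    by (rule closedin_continuous_map_preimage[OF lie_continuous[OF f]])
  then have "closed ?K" by simp
  moreover have "x - y \<in> ?K" if "x \<in> ?K" "y \<in> ?K" for x y
    using that lie_add[OF f, of x "- y"] lie_uminus[OF f, of y] by simp
  moreover have "?K \<noteq> UNIV" using ne by (auto simp: fun_eq_iff)
  moreover have "1 \<in> ?K" using f1 by simp
  \<comment> \<open>rescaling by a generator of the kernel makes the period equal to 1\<close>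
  ultimately obtain a where a: "a > 0" "\<And>t. t * a \<in> ?K \<longleftrightarrow> t \<in> \<int>"
    using closed_subgroup_of_reals[of ?K 1] by auto
  have "lie_scale a f t = \<one> \<longleftrightarrow> t \<in> \<int>" for t
    using a(2)[of t] by (simp add: lie_scale_def mult.commute)
  from image_is_torus_if_kernel_Ints[OF lie_scale_closed[OF f] this]
  show False using tf unfolding torus_free_def by blast
qed

lemma inj_on_lie_exp:
  assumes "torus_free G T"
  shows "inj_on lie_exp (carrier LG)"
proof (rule inj_onI)
  fix f g assume f: "f \<in> carrier LG" and g: "g \<in> carrier LG" and eq: "lie_exp f = lie_exp g"
  have "(f \<otimes>\<^bsub>LG\<^esub> inv\<^bsub>LG\<^esub> g) 1 = \<one>"
    using f g eq by (simp add: lie_inv lie_exp_def lie_closed)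
  then have "f \<otimes>\<^bsub>LG\<^esub> inv\<^bsub>LG\<^esub> g = \<one>\<^bsub>LG\<^esub>"
    using lie_exp_eq_one_imp_trivial[OF assms] f g by simp
  then show "f = g" using f g by (metis LG.inv_equality LG.inv_inv LG.inv_closed LG.m_comm)
qed

end

section \<open>The kernel of the exponential covering is closed\<close>

context profinite_lattice_group
begin

lemma V_sum_eq: "V_sum G T L = \<Union>L \<inter> lie_exp ` carrier LG"
proof
  let ?E = "lie_exp ` carrier LG"
  have "lie_exp \<in> hom LG G" by (auto simp: hom_def lie_exp_def lie_closed)
  then have "subgroup ?E G"
    by (intro group_hom.img_is_subgroup group_hom.intro group_hom_axioms.intro LG.is_group is_group)
  then have "subgroup (\<Union>L \<inter> ?E) G" by (rule subgroups_Inter_pair[OF subgroup_D])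
  moreover have "(\<Union>\<Delta>\<in>L. Z_Delta G T \<Delta>) \<subseteq> \<Union>L \<inter> ?E" by (auto simp: Z_Delta_def)
  ultimately show "V_sum G T L \<subseteq> \<Union>L \<inter> ?E" unfolding V_sum_def by (intro generate_subgroup_incl)
  have "\<Union>L \<inter> ?E \<subseteq> (\<Union>\<Delta>\<in>L. Z_Delta G T \<Delta>)" by (auto simp: Z_Delta_def)
  then show "\<Union>L \<inter> ?E \<subseteq> V_sum G T L"
    unfolding V_sum_def by (blast intro: generate.incl)
qed

text \<open>This is where injectivity of the exponential map is used: it makes \<open>inv_into\<close> a genuine inverse, so
  that \<open>(\<alpha>, f)\<close> is in the group exactly when \<open>f\<close> is inverse to the unique one-parameter subgroup
  through \<open>\<alpha>\<close>.\<close>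

lemma Gamma_subgroup_eq:
  assumes "torus_free G T"
  shows "Gamma_subgroup G T L = {p \<in> carrier (D \<times>\<times> LG). fst p \<otimes> snd p 1 = \<one>}"
proof (intro equalityI subsetI)
  note inj = inj_on_lie_exp[OF assms]
  fix p assume "p \<in> Gamma_subgroup G T L"
  then obtain \<alpha> where \<alpha>: "\<alpha> \<in> V_sum G T L" "p = (\<alpha>, inv\<^bsub>LG\<^esub> (inv_into (carrier LG) lie_exp \<alpha>))"
    by (auto simp: Gamma_subgroup_def)
  then obtain f where f: "f \<in> carrier LG" "\<alpha> = f 1" by (auto simp: V_sum_eq lie_exp_def)
  then have "inv_into (carrier LG) lie_exp \<alpha> = f" using inv_into_f_f[OF inj, of f] by (simp add: lie_exp_def)
  then show "p \<in> {p \<in> carrier (D \<times>\<times> LG). fst p \<otimes> snd p 1 = \<one>}"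
    using \<alpha> f by (simp add: V_sum_eq carrier_D lie_inv lie_closed)
next
  note inj = inj_on_lie_exp[OF assms]
  fix p assume "p \<in> {p \<in> carrier (D \<times>\<times> LG). fst p \<otimes> snd p 1 = \<one>}"
  then obtain \<alpha> f where p: "p = (\<alpha>, f)" "\<alpha> \<in> carrier D" "f \<in> carrier LG" "\<alpha> \<otimes> f 1 = \<one>"
    by (cases p) auto
  have "lie_exp (inv\<^bsub>LG\<^esub> f) = \<alpha>"
    using p carrier_D_subset lie_closed[OF p(3)] by (simp add: lie_exp_def lie_inv inv_equality subset_iff)
  moreover from this have "inv_into (carrier LG) lie_exp \<alpha> = inv\<^bsub>LG\<^esub> f"
    using inv_into_f_f[OF inj LG.inv_closed[OF p(3)]] by simp
  ultimately show "p \<in> Gamma_subgroup G T L"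
    unfolding Gamma_subgroup_def V_sum_eq using p LG.inv_closed[OF p(3)]
    by (intro image_eqI[of _ _ \<alpha>]) (auto simp: carrier_D)
qed

lemma subgroup_Gamma:
  assumes "torus_free G T"
  shows "subgroup (Gamma_subgroup G T L) (D \<times>\<times> LG)"
proof -
  have "(\<lambda>p. fst p \<otimes> snd p 1) \<in> hom (D \<times>\<times> LG) G"
    using carrier_D_subset by (auto simp: hom_def lie_closed m_ac mult_DirProd' subset_iff)
  moreover have "group (D \<times>\<times> LG)" by (intro DirProd_group D.is_group LG.is_group)
  ultimately interpret p: group_hom "D \<times>\<times> LG" G "\<lambda>p. fst p \<otimes> snd p 1"
    by (intro group_hom.intro group_hom_axioms.intro is_group)
  show ?thesis
    using p.subgroup_kernel by (simp add: Gamma_subgroup_eq[OF assms] kernel_def)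
qed

lemma closedin_Gamma:
  assumes "torus_free G T"
  shows "closedin (prod_topology TD TL) (Gamma_subgroup G T L)"
proof -
  have "continuous_map (prod_topology TD TL) T (\<lambda>p. fst p \<otimes> snd p 1)"
    using continuous_map_compose[OF continuous_map_fst identity_continuous_TD_T]
      continuous_map_compose[OF continuous_map_snd continuous_map_lie_eval]
    by (intro continuous_map_mult) (auto simp: o_def)
  moreover have "closedin T {\<one>}" using Hausdorff by (simp add: closedin_Hausdorff_singleton topspace_eq)
  ultimately have "closedin (prod_topology TD TL)
      {p \<in> topspace (prod_topology TD TL). fst p \<otimes> snd p 1 \<in> {\<one>}}"
    by (rule closedin_continuous_map_preimage)
  then show ?thesis
    by (simp add: Gamma_subgroup_eq[OF assms] D.topspace_eq_carrier LG.topspace_eq_carrier)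
qed

end

theorem proposition4:
  fixes G :: "('a, 'm) monoid_scheme" and T :: "'a topology" and L :: "'a set set"
  assumes "protorus G T" and "torus_free G T"
    and "profinite_sublattice G T L" and "\<Inter>L = {\<one>\<^bsub>G\<^esub>}"
  shows "periodic_group (Delta_hat G L) (Delta_hat_topology G L) \<and>
    (\<exists>s. topological_Zhat_module (Delta_hat G L) (Delta_hat_topology G L) s \<and>
      (\<forall>g\<in>carrier (Delta_hat G L).
        (\<lambda>z. s z g) ` carrier Zhat =
          Delta_hat_topology G L closure_of generate (Delta_hat G L) {g})) \<and>
    locally_compact_group (Delta_hat G L \<times>\<times> lie_group G T)
      (prod_topology (Delta_hat_topology G L) (lie_topology G T)) \<and>
    subgroup (Gamma_subgroup G T L) (Delta_hat G L \<times>\<times> lie_group G T) \<and>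
    closedin (prod_topology (Delta_hat_topology G L) (lie_topology G T)) (Gamma_subgroup G T L) \<and>
    continuous_map (Delta_hat_topology G L) (subtopology T (carrier (Delta_hat G L))) (\<lambda>x. x)"
proof -
  interpret topological_comm_group G T using assms(1) by (simp add: protorus_def)
  interpret profinite_lattice_group G T L
    using assms(3,4) by unfold_locales
  let ?S = "Delta_hat_topology G L"
  have "continuous_map ?S (subtopology T (carrier (Delta_hat G L))) (\<lambda>x. x)"
    using identity_continuous_TD_T by (auto simp: continuous_map_in_subtopology topspace_TD carrier_D)
  moreover have "locally_compact_space (prod_topology ?S (lie_topology G T))"
    using locally_compact_D locally_compact_lie assms(1)
    by (simp add: locally_compact_space_prod_topology locally_compact_group_def protorus_def)
  then have "locally_compact_group (Delta_hat G L \<times>\<times> lie_group G T) (prod_topology ?S (lie_topology G T))"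
    unfolding locally_compact_group_def
    using topological_comm_group_DirProd[OF topological_comm_group_D topological_comm_group_lie] by blast
  moreover have "topological_Zhat_module (Delta_hat G L) ?S zpow"
    unfolding topological_Zhat_module_def using module_zpow continuous_zpow by blast
  ultimately show ?thesis
    using periodic_D zpow_image_eq_closure subgroup_Gamma[OF assms(2)] closedin_Gamma[OF assms(2)] by blast
qed

end
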